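(* Let $f(x)\in\mathbb{Z}[x]$ be a polynomial of degree at least three with positive leading coefficient, and suppose that, for some non-zero polynomials $G(x),g(x)\in\mathbb{Z}[x]$, $f(x)$ has one of the following forms: (i) $x^{2}(x+1)g(x)$; (ii) $x(x+1)G(x)-x-1$; (iii) $x(x+1)^{2}g(x)-1$; (iv) $x(x+1)\big((x-1)g(x)+2\big)-2x-1$; (v) $x(x+1)\big((x+2)g(x)-2\big)-2x-2$; (vi) $x(x+1)\big(x(x-1)g(x)+1\big)-x$; (vii) $x(x+1)\big((x+2)(x+1)g(x)-1\big)-x-2$. Let $M>0$ be an integer such that $f(M)>0$, $f$ is strictly increasing on $[M,\infty)$, and $f_j(M)\neq 0,-1$ for all $j\geq 0$. Then the real number \[ \prod_{j=0}^{\infty}\left(1+\frac{1}{f_j(M)}\right) \] is transcendental.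
   Context: $f_0(x)=x$ and $f_{j+1}(x)=f(f_j(x))$ for $j\ge0$, so $f_j(M)$ is the $j$-th iterate of $f$ evaluated at $M$.
   Formalization: Convergence of the infinite product (to a non-zero limit) is added as a hypothesis; the stated conditions do not ensure it, e.g. form (iv) with g=1, f=x^3+2x^2-x-1, M=1 has f_j(1)=1 for all j, so the product diverges. *)

theory Defs
  imports "HOL-Analysis.Analysis" "HOL-Computational_Algebra.Computational_Algebra"
begin

definition admissible_form :: "int poly \<Rightarrow> bool" where
  "admissible_form f \<longleftrightarrow>
    (let x = [:0, 1:] in
      \<exists>G g :: int poly. G \<noteq> 0 \<and> g \<noteq> 0 \<and>
        (f = x^2 * (x + 1) * g \<or>
         f = x * (x + 1) * G - x - 1 \<or>
         f = x * (x + 1)^2 * g - 1 \<or>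
         f = x * (x + 1) * ((x - 1) * g + 2) - 2 * x - 1 \<or>
         f = x * (x + 1) * ((x + 2) * g - 2) - 2 * x - 2 \<or>
         f = x * (x + 1) * (x * (x - 1) * g + 1) - x \<or>
         f = x * (x + 1) * ((x + 2) * (x + 1) * g - 1) - x - 2))"

text \<open>
  The iterate \<open>f\<^sub>j(M)\<close> is \<open>(poly f ^^ j) M\<close>. Since \<open>M\<close> may be a point whose orbit
  reaches the fixed point 1 (for instance \<open>M = 1\<close> and
  \<open>f = x (x + 1) ((x - 1) g + 2) - 2 x - 1\<close>, for which \<open>f 1 = 1\<close>), the infinite product
  of these factors need not converge.
\<close>

definition orbit_factor :: "int poly \<Rightarrow> int \<Rightarrow> nat \<Rightarrow> real" where
  "orbit_factor f M j = 1 + 1 / real_of_int ((poly f ^^ j) M)"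

end

theory Submission
  imports Defs "HOL-Library.Landau_Symbols"
begin

text \<open>
  This is Mahler's method along the orbit \<open>X n = f\<^sub>n(M)\<close>. The tails \<open>\<phi> n\<close> of the product satisfy
  \<open>\<phi> n = (1 + 1 / X n) * \<phi> (n + 1)\<close>, and \<open>\<phi> n = \<alpha> * q n / p n\<close> for the product \<open>\<alpha>\<close>, where the
  integers \<open>p n\<close>, \<open>q n\<close> are of size \<open>O(X n)\<close>. Counting unknowns gives integer polynomials \<open>P i\<close>,
  \<open>i \<le> k\<close>, of degree at most \<open>N\<close>, not all zero, for which the sum \<open>E n\<close> of the
  \<open>P i (X n) * \<phi> n ^ i\<close> is as small as the power \<open>-k * (N + 1)\<close> of \<open>X n\<close>. If \<open>E n\<close> vanished
  infinitely often, it would be smaller than every power of \<open>X n\<close>; eliminating the leading term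
  between \<open>E n\<close> and \<open>E (n + 1)\<close> would then yield a rational solution of the functional equation of
  a power of the product, and counting zeros and poles shows that there is none. The seven forms enter
  only here: each maps 0 or \<open>-1\<close> into \<open>{0, -1}\<close>. Since \<open>p n ^ k * E n\<close> is an integer polynomial
  in \<open>\<alpha>\<close>, it violates Liouville's inequality when \<open>\<alpha>\<close> is algebraic of degree \<open>D\<close>, \<open>k = D\<close> and
  \<open>N = D * D\<close>.
\<close>

section \<open>Siegel's lemma and Liouville's inequality\<close>

text \<open>Pigeonhole: the integer vectors with entries in \<open>{0..X}\<close> outnumber the
  possible values of the \<open>m\<close> forms, so two of them agree under all forms and their
  difference is the solution. Its entries are at most \<open>X = (card I * A) ^ m\<close>.\<close>

lemma siegel_lemma:
  fixes a :: "nat \<Rightarrow> 'i \<Rightarrow> int" and A m :: nat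
  assumes card: "card I = Suc m" and A: "A \<ge> 1"
    and bound: "\<And>t i. t < m \<Longrightarrow> i \<in> I \<Longrightarrow> \<bar>a t i\<bar> \<le> int A"
  shows "\<exists>c :: 'i \<Rightarrow> int. (\<exists>i\<in>I. c i \<noteq> 0) \<and> (\<forall>i\<in>I. \<bar>c i\<bar> \<le> int ((card I * A) ^ m)) \<and>
           (\<forall>t<m. (\<Sum>i\<in>I. a t i * c i) = 0)"
proof -
  have fin: "finite I" using card card.infinite by fastforce
  define N where "N = Suc m * A"
  define X where "X = N ^ m"
  define V where "V = (PiE I (\<lambda>_. {0..int X}))"
  \<comment> \<open>\<open>lo t\<close> is the least value of the form \<open>t\<close> on the box;
    the greatest is at most \<open>N * X\<close> larger, which gives the box
    \<open>W\<close>.\<close>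
  define lo where "lo t = (\<Sum>i\<in>I. min 0 (a t i)) * int X" for t
  define F where "F c = (\<lambda>t\<in>{..<m}. (\<Sum>i\<in>I. a t i * c i))" for c :: "'i \<Rightarrow> int"
  define W where "W = (PiE {..<m} (\<lambda>t. {lo t .. lo t + int (N * X)}))"
  have N: "N \<ge> 1" using A by (simp add: N_def)
  have "F ` V \<subseteq> W"
  proof
    fix w assume "w \<in> F ` V"
    then obtain c where c: "c \<in> V" "w = F c" by auto
    have cb: "0 \<le> c i" "c i \<le> int X" if "i \<in> I" for i
      using c that by (auto simp: V_def PiE_def Pi_def)
    have "lo t \<le> (\<Sum>i\<in>I. a t i * c i)" for t
      unfolding lo_def sum_distrib_right
    proof (rule sum_mono)
      fix i assume i: "i \<in> I"
      show "min 0 (a t i) * int X \<le> a t i * c i"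
      proof (cases "a t i \<ge> 0")
        case False
        then show ?thesis using cb[OF i] by (simp add: min_def mult_left_mono_neg)
      qed (use cb[OF i] in auto)
    qed
    moreover have "(\<Sum>i\<in>I. a t i * c i) \<le> lo t + int (N * X)" if t: "t < m" for t
    proof -
      have "(\<Sum>i\<in>I. a t i * c i) \<le> (\<Sum>i\<in>I. (min 0 (a t i) + int A) * int X)"
      proof (rule sum_mono)
        fix i assume i: "i \<in> I"
        have 1: "a t i \<le> min 0 (a t i) + int A" using bound[OF t i] by linarith
        have 2: "0 \<le> min 0 (a t i) + int A" using bound[OF t i] by linarith
        have "a t i * c i \<le> (min 0 (a t i) + int A) * c i" using 1 cb[OF i] by (simp add: mult_right_mono)
        also have "\<dots> \<le> (min 0 (a t i) + int A) * int X" using 2 cb[OF i] by (simp add: mult_left_mono)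
        finally show "a t i * c i \<le> (min 0 (a t i) + int A) * int X" .
      qed
      also have "\<dots> = lo t + int (N * X)"
        by (simp add: lo_def N_def sum_distrib_left sum.distrib card algebra_simps)
      finally show ?thesis .
    qed
    ultimately show "w \<in> W" by (auto simp: c F_def W_def)
  qed
  have finW: "finite W" unfolding W_def by (intro finite_PiE) auto
  have cardW: "card W = (N * X + 1) ^ m"
    unfolding W_def by (subst card_PiE) (auto simp: nat_add_distrib nat_mult_distrib)
  have cardV: "card V = (X + 1) ^ Suc m"
    unfolding V_def using card by (subst card_PiE[OF fin]) (auto simp: nat_add_distrib)
  \<comment> \<open>The choice of \<open>X\<close> enters here: the factor \<open>N ^ m\<close> is
    exactly \<open>X\<close>, just less than the extra factor \<open>X + 1\<close> in
    \<open>card V\<close>.\<close>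
  have "(N * X + 1) ^ m \<le> (N * (X + 1)) ^ m"
    using N by (intro power_mono) auto
  also have "\<dots> = X * (X + 1) ^ m" unfolding power_mult_distrib X_def ..
  also have "\<dots> < (X + 1) ^ Suc m" by simp
  finally have "card W < card V" using cardW cardV by simp
  then have "\<not> inj_on F V"
    using \<open>F ` V \<subseteq> W\<close> finW by (metis card_inj_on_le leD)
  then obtain u v where uv: "u \<in> V" "v \<in> V" "F u = F v" "u \<noteq> v" by (auto simp: inj_on_def)
  define c where "c i = u i - v i" for i
  have b: "0 \<le> u i" "u i \<le> int X" "0 \<le> v i" "v i \<le> int X" if "i \<in> I" for i
    using uv that by (auto simp: V_def PiE_def Pi_def)
  have "\<exists>i\<in>I. c i \<noteq> 0"
    using PiE_ext[of u I "\<lambda>_. {0..int X}" v] uv by (auto simp: V_def c_def)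
  moreover have "\<bar>c i\<bar> \<le> int ((card I * A) ^ m)" if "i \<in> I" for i
    using b[OF that] by (simp add: c_def card X_def N_def abs_le_iff del: of_nat_power of_nat_mult)
  moreover have "(\<Sum>i\<in>I. a t i * c i) = 0" if "t < m" for t
  proof -
    have "F u t = F v t" using uv by simp
    then show ?thesis using that by (simp add: F_def c_def algebra_simps sum_subtractf)
  qed
  ultimately show ?thesis by blast
qed

section \<open>Integer polynomials evaluated in other rings\<close>

abbreviation of_int_poly :: "int poly \<Rightarrow> 'a::comm_ring_1 poly" where
  "of_int_poly \<equiv> map_poly of_int"

lemma of_int_poly_add: "of_int_poly (p + q) = (of_int_poly p + of_int_poly q :: 'a::comm_ring_1 poly)"
  by (intro poly_eqI) (simp add: coeff_map_poly)

lemma of_int_poly_mult: "of_int_poly (p * q) = (of_int_poly p * of_int_poly q :: 'a::comm_ring_1 poly)"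
  by (intro poly_eqI) (simp add: coeff_map_poly coeff_mult)

lemma of_int_poly_power: "of_int_poly (p ^ n) = (of_int_poly p ^ n :: 'a::comm_ring_1 poly)"
  by (induction n) (simp_all add: of_int_poly_mult)

lemma of_int_poly_pcompose:
  "of_int_poly (pcompose p q) = (pcompose (of_int_poly p) (of_int_poly q) :: 'a::comm_ring_1 poly)"
  by (induction p) (simp_all add: pcompose_pCons of_int_poly_add of_int_poly_mult map_poly_pCons)

lemma poly_of_int_poly_eq_sum:
  fixes x :: "'a::{comm_ring_1,ring_char_0}"
  assumes "degree p < n"
  shows "poly (of_int_poly p) x = (\<Sum>i<n. of_int (coeff p i) * x ^ i)"
proof -
  have "poly (of_int_poly p) x = (\<Sum>i\<le>degree p. of_int (coeff p i) * x ^ i)"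
    by (simp add: poly_altdef degree_map_poly coeff_map_poly)
  also have "\<dots> = (\<Sum>i<n. of_int (coeff p i) * x ^ i)"
    using assms by (intro sum.mono_neutral_left) (auto simp: coeff_eq_0)
  finally show ?thesis .
qed

text \<open>\<open>A\<close> need not be monic, so each pseudo-division by \<open>A\<close> costs a
  nonzero integer factor; \<open>W\<close> collects these into a common denominator for all powers
  up to \<open>K\<close>.\<close>

lemma powers_reduce_modulo:
  fixes \<alpha> :: real and A :: "int poly"
  assumes A: "degree A \<ge> 1" "poly (of_int_poly A) \<alpha> = 0"
  shows "\<exists>W::int. W \<noteq> 0 \<and> (\<forall>j\<le>K. \<exists>r. degree r < degree A \<and> of_int W * \<alpha> ^ j = poly (of_int_poly r) \<alpha>)"
proof (induction K)
  case 0
  show ?case using A by (intro exI[of _ 1]) (auto intro!: exI[of _ 1])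
next
  case (Suc K)
  then obtain W where W: "W \<noteq> 0"
    "\<And>j. j \<le> K \<Longrightarrow> \<exists>r. degree r < degree A \<and> of_int W * \<alpha> ^ j = poly (of_int_poly r) \<alpha>" by blast
  have "A \<noteq> 0" using A by auto
  from pseudo_mod[OF this, of "monom 1 (Suc K)"] obtain a q r where
    a: "a \<noteq> 0" "smult a (monom 1 (Suc K)) = A * q + r" and r: "r = 0 \<or> degree r < degree A" by blast
  have r': "degree r < degree A" using r A by auto
  have "poly (of_int_poly (smult a (monom 1 (Suc K)))) \<alpha> = poly (of_int_poly r) \<alpha>"
    unfolding a using A by (simp add: of_int_poly_add of_int_poly_mult)
  then have ar: "of_int a * \<alpha> ^ Suc K = poly (of_int_poly r) \<alpha>"
    by (simp add: map_poly_monom map_poly_smult poly_monom smult_monom)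
  \<comment> \<open>Remainders may be rescaled: those of the old powers by \<open>a\<close>, the new
    one by \<open>W\<close>.\<close>
  have sm: "of_int (b * w) * z = poly (of_int_poly (smult b r)) \<alpha>" "degree (smult b r) < degree A"
    if "degree r < degree A" "of_int w * z = poly (of_int_poly r) \<alpha>" for b w z and r :: "int poly"
    using that(1) that(2)[symmetric] by (auto simp: map_poly_smult)
  show ?case
  proof (intro exI[of _ "a * W"] conjI allI impI)
    show "a * W \<noteq> 0" using a W by simp
    fix j assume "j \<le> Suc K"
    then consider "j \<le> K" | "j = Suc K" by linarith
    then show "\<exists>r. degree r < degree A \<and> of_int (a * W) * \<alpha> ^ j = poly (of_int_poly r) \<alpha>"
    proof cases
      case 1
      then show ?thesis using W(2)[of j] sm by blast
    next
      case 2
      then show ?thesis using sm[OF r' ar, of W] by (metis mult.commute)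
    qed
  qed
qed

text \<open>
  Siegel's lemma replaces the norm: it supplies a polynomial \<open>C\<close> in \<open>\<alpha>\<close>, of size \<open>O(H ^ (D - 1))\<close>, for
  which \<open>C * B\<close> is a nonzero rational number of bounded denominator.
\<close>
lemma algebraic_liouville_bound:
  fixes \<alpha> :: real
  assumes "algebraic \<alpha>"
  obtains D :: nat where "D \<ge> 1"
    "\<And>k. \<exists>c>0. \<forall>(B::int poly) (H::nat). degree B \<le> k \<longrightarrow> H \<ge> 1 \<longrightarrow> (\<forall>i. \<bar>coeff B i\<bar> \<le> int H) \<longrightarrow>
        poly (of_int_poly B) \<alpha> \<noteq> 0 \<longrightarrow> c \<le> \<bar>poly (of_int_poly B) \<alpha>\<bar> * real H ^ (D - 1)"
proof -
  define R where "R D \<longleftrightarrow> (\<exists>A::int poly. A \<noteq> 0 \<and> degree A = D \<and> poly (of_int_poly A) \<alpha> = 0)" for D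
  \<comment> \<open>\<open>D\<close> is the degree of \<open>\<alpha>\<close>; by minimality the
    auxiliary polynomial \<open>C\<close> below, of smaller degree, cannot vanish at
    \<open>\<alpha>\<close>.\<close>
  define D where "D = (LEAST D. R D)"
  have "\<exists>D. R D" using assms by (auto simp: R_def elim!: algebraicE')
  then have "R D" unfolding D_def by (rule LeastI_ex)
  then obtain A :: "int poly" where A: "A \<noteq> 0" "degree A = D" "poly (of_int_poly A) \<alpha> = 0" by (auto simp: R_def)
  have min: "poly (of_int_poly C) \<alpha> \<noteq> 0" if "C \<noteq> 0" "degree C < D" for C
    using not_less_Least[of "degree C" R] that by (auto simp: R_def D_def)
  have D1: "D \<ge> 1"
  proof (rule ccontr)
    assume "\<not> D \<ge> 1"
    then have "degree A = 0" using A by simp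
    then obtain a where "A = [:a:]" by (metis degree_eq_zeroE)
    then show False using A by (simp add: map_poly_pCons)
  qed
  show ?thesis
  proof (rule that[OF D1])
    fix k
    \<comment> \<open>The range \<open>k + D\<close> covers every power occurring in a product of
      \<open>B\<close> with a polynomial of degree below \<open>D\<close>.\<close>
    obtain W :: int where W: "W \<noteq> 0"
      "\<forall>j\<le>k+D. \<exists>r. degree r < D \<and> of_int W * \<alpha> ^ j = poly (of_int_poly r) \<alpha>"
      using powers_reduce_modulo[of A \<alpha> "k + D"] A D1 by auto
    then obtain r where r: "\<And>j. j \<le> k + D \<Longrightarrow> degree (r j) < D"
      "\<And>j. j \<le> k + D \<Longrightarrow> of_int W * \<alpha> ^ j = poly (of_int_poly (r j)) \<alpha>"
      by metis
    define N where "N = nat (\<Sum>j\<le>k+D. \<Sum>t<D. \<bar>coeff (r j) t\<bar>) + 1"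
    have N: "\<bar>coeff (r j) t\<bar> \<le> int N" if "j \<le> k + D" "t < D" for j t
    proof -
      have "\<bar>coeff (r j) t\<bar> \<le> (\<Sum>t<D. \<bar>coeff (r j) t\<bar>)"
        using that by (intro member_le_sum) auto
      also have "\<dots> \<le> (\<Sum>j\<le>k+D. \<Sum>t<D. \<bar>coeff (r j) t\<bar>)"
        using that by (intro member_le_sum[of j "{..k+D}" "\<lambda>j. \<Sum>t<D. \<bar>coeff (r j) t\<bar>"]) (auto intro: sum_nonneg)
      finally show ?thesis unfolding N_def by linarith
    qed
    define S where "S = (\<Sum>i<D. \<bar>\<alpha>\<bar> ^ i)"
    have "S \<ge> \<bar>\<alpha>\<bar> ^ 0" unfolding S_def using D1 by (intro member_le_sum) auto
    then have S: "S \<ge> 1" by simp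
    \<comment> \<open>The constant that remains when the factor \<open>H ^ (D - 1)\<close> is split
      off the bound for \<open>\<bar>W * C\<bar>\<close> at \<open>\<alpha>\<close>.\<close>
    define G where "G = \<bar>of_int W\<bar> * real (D * ((k+1) * N)) ^ (D - 1) * S"
    have "N > 0" by (simp add: N_def)
    then have "D * ((k+1) * N) > 0" using D1 by simp
    then have "real (D * ((k+1) * N)) > 0" unfolding of_nat_0_less_iff .
    then have G: "G > 0" unfolding G_def using W S by (intro mult_pos_pos zero_less_power) auto
    show "\<exists>c>0. \<forall>(B::int poly) (H::nat). degree B \<le> k \<longrightarrow> H \<ge> 1 \<longrightarrow> (\<forall>i. \<bar>coeff B i\<bar> \<le> int H) \<longrightarrow>
        poly (of_int_poly B) \<alpha> \<noteq> 0 \<longrightarrow> c \<le> \<bar>poly (of_int_poly B) \<alpha>\<bar> * real H ^ (D - 1)"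
    proof (intro exI[of _ "1 / G"] conjI allI impI)
      show "1 / G > 0" using G by simp
      fix B :: "int poly" and H :: nat
      assume B: "degree B \<le> k" "H \<ge> 1" "\<forall>i. \<bar>coeff B i\<bar> \<le> int H" "poly (of_int_poly B) \<alpha> \<noteq> 0"
      \<comment> \<open>\<open>e t i\<close> is the coefficient of \<open>\<alpha> ^ t\<close> in
        the reduced form of \<open>W * \<alpha> ^ i * B\<close>.\<close>
      define e where "e t i = (\<Sum>l\<le>k. coeff B l * coeff (r (i + l)) t)" for t i
      have eb: "\<bar>e t i\<bar> \<le> int ((k+1) * N * H)" if "t < D" "i < D" for t i
      proof -
        have "\<bar>e t i\<bar> \<le> (\<Sum>l\<le>k. \<bar>coeff B l * coeff (r (i + l)) t\<bar>)" unfolding e_def by (rule sum_abs)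
        also have "\<dots> \<le> (\<Sum>l\<le>k. int H * int N)"
          using B(3) N that by (intro sum_mono) (auto simp: abs_mult intro!: mult_mono)
        also have "\<dots> = int ((k+1) * N * H)" by (simp add: algebra_simps)
        finally show ?thesis .
      qed
      \<comment> \<open>With \<open>D\<close> unknowns, the \<open>D - 1\<close> coefficients of the
        positive powers of \<open>\<alpha>\<close> can be made zero; the shift by \<open>Suc\<close>
        spares the constant term.\<close>
      obtain c where c: "\<exists>i\<in>{..<D}. c i \<noteq> 0" "\<forall>i\<in>{..<D}. \<bar>c i\<bar> \<le> int ((D * ((k+1) * N * H)) ^ (D - 1))"
         "\<forall>t<D-1. (\<Sum>i<D. e (Suc t) i * c i) = 0"
        using siegel_lemma[of "{..<D}" "D - 1" "(k+1)*N*H" "\<lambda>t. e (Suc t)"] D1 eb B(2) by (auto simp: N_def)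
      define C where "C = (\<Sum>i<D. monom (c i) i)"
      have coC: "coeff C i = (if i < D then c i else 0)" for i
        by (auto simp: C_def coeff_sum if_distrib cong: if_cong)
      have C0: "C \<noteq> 0" using c(1) coC by (metis coeff_0 lessThan_iff)
      have degC: "degree C < D" using D1 coC
        by (metis C0 leading_coeff_neq_0)
      have Ca: "poly (of_int_poly C) \<alpha> = (\<Sum>i<D. of_int (c i) * \<alpha> ^ i)"
        using poly_of_int_poly_eq_sum[OF degC, of \<alpha>] coC by simp
      have Ba: "poly (of_int_poly B) \<alpha> = (\<Sum>l\<le>k. of_int (coeff B l) * \<alpha> ^ l)"
        using poly_of_int_poly_eq_sum[of B "Suc k" \<alpha>] B(1) by (simp add: lessThan_Suc_atMost)
      have "of_int W * (poly (of_int_poly C) \<alpha> * poly (of_int_poly B) \<alpha>)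
          = (\<Sum>i<D. \<Sum>l\<le>k. of_int (c i) * of_int (coeff B l) * (of_int W * \<alpha> ^ (i + l)))"
        unfolding Ca Ba sum_product unfolding sum_distrib_left
        by (intro sum.cong refl) (simp add: power_add mult_ac)
      also have "\<dots> = (\<Sum>i<D. \<Sum>l\<le>k. \<Sum>t<D. of_int (c i) * of_int (coeff B l) * (of_int (coeff (r (i + l)) t) * \<alpha> ^ t))"
        using r poly_of_int_poly_eq_sum[OF r(1), of _ \<alpha>]
        by (intro sum.cong refl) (simp add: sum_distrib_left)
      also have "\<dots> = (\<Sum>i<D. \<Sum>t<D. \<Sum>l\<le>k. of_int (c i) * of_int (coeff B l) * (of_int (coeff (r (i + l)) t) * \<alpha> ^ t))"
        by (intro sum.cong refl sum.swap)
      also have "\<dots> = (\<Sum>t<D. \<Sum>i<D. \<Sum>l\<le>k. of_int (c i) * of_int (coeff B l) * (of_int (coeff (r (i + l)) t) * \<alpha> ^ t))"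
        by (rule sum.swap)
      also have "\<dots> = (\<Sum>t<D. of_int (\<Sum>i<D. e t i * c i) * \<alpha> ^ t)"
        by (simp add: e_def sum_distrib_left sum_distrib_right mult_ac)
      also have "\<dots> = (\<Sum>t\<in>{0}. of_int (\<Sum>i<D. e t i * c i) * \<alpha> ^ t)"
      proof (rule sum.mono_neutral_right)
        show "\<forall>t\<in>{..<D} - {0}. real_of_int (\<Sum>i<D. e t i * c i) * \<alpha> ^ t = 0"
        proof
          fix t assume "t \<in> {..<D} - {0}"
          then obtain s where "t = Suc s" "s < D - 1" by (cases t) auto
          then show "real_of_int (\<Sum>i<D. e t i * c i) * \<alpha> ^ t = 0" using c(3) by simp
        qed
      qed (use D1 in auto)
      finally have eq: "of_int W * (poly (of_int_poly C) \<alpha> * poly (of_int_poly B) \<alpha>) = of_int (\<Sum>i<D. e 0 i * c i)"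
        by simp
      \<comment> \<open>A nonzero integer has absolute value at least 1; it remains to bound
        \<open>C\<close> from above.\<close>
      have "of_int W * (poly (of_int_poly C) \<alpha> * poly (of_int_poly B) \<alpha>) \<noteq> 0"
        using min[OF C0 degC] B(4) W by simp
      then have ge: "1 \<le> \<bar>of_int W * (poly (of_int_poly C) \<alpha> * poly (of_int_poly B) \<alpha>)\<bar>"
        unfolding eq by (metis of_int_0_eq_iff of_int_abs of_int_1_le_iff zero_less_abs_iff int_one_le_iff_zero_less)
      have "\<bar>poly (of_int_poly C) \<alpha>\<bar> \<le> (\<Sum>i<D. \<bar>of_int (c i) * \<alpha> ^ i\<bar>)" unfolding Ca by (rule sum_abs)
      also have "\<dots> \<le> (\<Sum>i<D. real ((D * ((k+1) * N * H)) ^ (D - 1)) * \<bar>\<alpha>\<bar> ^ i)"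
      proof (rule sum_mono)
        fix i assume "i \<in> {..<D}"
        then have "\<bar>c i\<bar> \<le> int ((D * ((k+1) * N * H)) ^ (D - 1))" using c(2) by blast
        then have "real_of_int \<bar>c i\<bar> \<le> real_of_int (int ((D * ((k+1) * N * H)) ^ (D - 1)))" by (rule of_int_le_iff[THEN iffD2])
        then have "\<bar>real_of_int (c i)\<bar> \<le> real ((D * ((k+1) * N * H)) ^ (D - 1))"
          unfolding of_int_abs of_int_of_nat_eq .
        then show "\<bar>of_int (c i) * \<alpha> ^ i\<bar> \<le> real ((D * ((k+1) * N * H)) ^ (D - 1)) * \<bar>\<alpha>\<bar> ^ i"
          unfolding abs_mult power_abs by (rule mult_right_mono) simp
      qed
      also have "\<dots> = real (D * ((k+1) * N)) ^ (D - 1) * real H ^ (D - 1) * S"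
        unfolding S_def sum_distrib_left by (simp add: power_mult_distrib mult_ac)
      finally have Cle: "\<bar>poly (of_int_poly C) \<alpha>\<bar> \<le> real (D * ((k+1) * N)) ^ (D - 1) * real H ^ (D - 1) * S" .
      have "1 \<le> \<bar>of_int W\<bar> * (\<bar>poly (of_int_poly C) \<alpha>\<bar> * \<bar>poly (of_int_poly B) \<alpha>\<bar>)"
        using ge by (simp add: abs_mult)
      also have "\<dots> \<le> \<bar>of_int W\<bar> * ((real (D * ((k+1) * N)) ^ (D - 1) * real H ^ (D - 1) * S) * \<bar>poly (of_int_poly B) \<alpha>\<bar>)"
        by (intro mult_left_mono mult_right_mono Cle) auto
      also have "\<dots> = G * (\<bar>poly (of_int_poly B) \<alpha>\<bar> * real H ^ (D - 1))"
        by (simp add: G_def mult_ac)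
      finally show "1 / G \<le> \<bar>poly (of_int_poly B) \<alpha>\<bar> * real H ^ (D - 1)"
        using G by (simp add: field_simps)
    qed
  qed
qed

section \<open>The functional equation has no rational solution\<close>

lemma pcompose_nonzero:
  fixes p q :: "'a::idom poly"
  assumes "p \<noteq> 0" "degree q > 0"
  shows "pcompose p q \<noteq> 0"
  using assms pcompose_eq_0 by blast

lemma order_power:
  fixes p :: "'a::idom poly"
  assumes "p \<noteq> 0"
  shows "order a (p ^ n) = n * order a p"
  using assms by (induction n) (simp_all add: order_mult order_0I)

text \<open>With \<open>s = poly f a\<close>, split \<open>p\<close> as
  \<open>(x - s) ^ n * q\<close> where \<open>q\<close> does not vanish at \<open>s\<close>;
  composing with \<open>f\<close> turns this into \<open>(f - s) ^ n\<close> times a factor not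
  vanishing at \<open>a\<close>. The second order in the product is the ramification index of
  \<open>f\<close> at \<open>a\<close>.\<close>

lemma order_pcompose:
  fixes p f :: "'a::idom poly"
  assumes "p \<noteq> 0" "degree f > 0"
  shows "order a (pcompose p f) = order (poly f a) p * order a (f - [:poly f a:])"
proof -
  define s where "s = poly f a"
  define n where "n = order s p"
  obtain q where q: "p = [:-s, 1:] ^ n * q" "\<not> [:-s, 1:] dvd q"
    using order_decomp[OF assms(1), of s] by (auto simp: n_def)
  have q0: "poly q s \<noteq> 0" using q(2) by (simp add: poly_eq_0_iff_dvd)
  have "pcompose p f = (f - [:s:]) ^ n * pcompose q f"
  proof -
    have "pcompose ([:-s, 1:] ^ m) f = (f - [:s:]) ^ m" for m
    proof (induction m)
      case (Suc m)
      have "pcompose [:-s, 1:] f = f - [:s:]" by (simp add: pcompose_pCons)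
      then show ?case unfolding power_Suc pcompose_mult Suc.IH by simp
    qed (simp add: pcompose_1)
    then show ?thesis by (subst q(1)) (simp add: pcompose_mult)
  qed
  moreover have "f - [:s:] \<noteq> 0" using assms(2) by (metis degree_pCons_0 eq_iff_diff_eq_0 less_numeral_extra(3))
  moreover have "poly (pcompose q f) a \<noteq> 0" using q0 by (simp add: poly_pcompose s_def)
  moreover have "pcompose p f \<noteq> 0" using assms by (rule pcompose_nonzero)
  ultimately show ?thesis
    by (simp add: order_mult order_power order_0I n_def s_def)
qed

lemma sum_order_complex:
  fixes p :: "complex poly"
  assumes "p \<noteq> 0"
  shows "(\<Sum>a | poly p a = 0. order a p) = degree p"
  using size_proots_complex[of p] assms by (simp add: size_multiset_overloaded_eq)

text \<open>Riemann-Hurwitz for polynomials: every fibre has \<open>degree f\<close> points counted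
  with multiplicity, the multiplicity exceeds the order of \<open>pderiv f\<close> by one, and these
  orders sum to at most \<open>degree f - 1\<close> over the plane.\<close>

lemma card_preimage_ge:
  fixes f :: "complex poly"
  assumes "finite S" "degree f > 0"
  shows "degree f * card S \<le> card {a. poly f a \<in> S} + (degree f - 1)"
proof -
  let ?F = "\<lambda>s. {a. poly (f - [:s:]) a = 0}"
  have nz: "f - [:s:] \<noteq> 0" for s
    using assms(2) by (metis degree_pCons_0 eq_iff_diff_eq_0 less_numeral_extra(3))
  have deg: "degree (f - [:s:]) = degree f" for s
    using assms(2) degree_add_eq_left[of "-[:s:]" f] by (simp add: diff_conv_add_uminus del: minus_pCons add_uminus_conv_diff)
  have pd: "pderiv (f - [:s:]) = pderiv f" for s by (simp add: pderiv_diff pderiv_pCons)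
  have pd0: "pderiv f \<noteq> 0" using assms(2) by (simp add: pderiv_eq_0_iff)
  have fin: "finite (?F s)" for s using nz by (rule poly_roots_finite)
  have un: "{a. poly f a \<in> S} = (\<Union>s\<in>S. ?F s)" by auto
  have finU: "finite {a. poly f a \<in> S}" unfolding un using assms fin by blast
  have "degree f * card S = (\<Sum>s\<in>S. \<Sum>a\<in>?F s. order a (f - [:s:]))"
    unfolding sum_order_complex[OF nz] deg by simp
  also have "\<dots> = (\<Sum>s\<in>S. \<Sum>a\<in>?F s. Suc (order a (pderiv f)))"
    by (intro sum.cong refl) (metis (mono_tags) mem_Collect_eq nz order_pderiv pd)
  also have "\<dots> = (\<Sum>a\<in>(\<Union>s\<in>S. ?F s). Suc (order a (pderiv f)))"
    using assms fin by (intro sum.UNION_disjoint[symmetric]) auto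
  also have "\<dots> = card {a. poly f a \<in> S} + (\<Sum>a\<in>{a. poly f a \<in> S}. order a (pderiv f))"
    unfolding un by (simp only: sum_Suc)
  also have "(\<Sum>a\<in>{a. poly f a \<in> S}. order a (pderiv f)) = (\<Sum>a\<in>{a. poly f a \<in> S \<and> poly (pderiv f) a = 0}. order a (pderiv f))"
    using finU by (intro sum.mono_neutral_right) (auto simp: order_root)
  also have "\<dots> \<le> (\<Sum>a | poly (pderiv f) a = 0. order a (pderiv f))"
    using pd0 by (intro sum_mono2 poly_roots_finite) auto
  also have "\<dots> = degree f - 1" using pd0 by (simp add: sum_order_complex degree_pderiv)
  finally show ?thesis by simp
qed

text \<open>
  The divisor of a rational solution \<open>P / Q\<close> has at least two points in its support \<open>S\<close>, and the
  equation forces the preimage of \<open>S\<close> into \<open>S \<union> {0, -1}\<close>. Riemann-Hurwitz leaves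
  only the case that the degree is three, \<open>S\<close> has two points, and \<open>S\<close> is disjoint from \<open>{0, -1}\<close>
  while containing the images of 0 and \<open>-1\<close>.
\<close>
lemma no_rational_solution_complex:
  fixes f P Q :: "complex poly"
  assumes d: "degree f \<ge> 3"
    and f01: "poly f 0 \<in> {0, -1} \<or> poly f (-1) \<in> {0, -1}"
    and nz: "P \<noteq> 0" "Q \<noteq> 0" and k: "k \<ge> 1"
    and eq: "Q * pcompose P f * [:1, 1:] ^ k = pcompose Q f * [:0, 1:] ^ k * P"
  shows False
proof -
  \<comment> \<open>\<open>o'\<close> is the divisor of \<open>R = P / Q\<close>, \<open>e\<close>
    the ramification index. The hypothesis reads
    \<open>R (f x) * (1 + x) ^ k = x ^ k * R x\<close>.\<close>
  define o' where "o' a = int (order a P) - int (order a Q)" for a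
  define e where "e a = order a (f - [:poly f a:])" for a
  define S where "S = {a. o' a \<noteq> 0}"
  have d0: "degree f > 0" using d by simp
  have nzf: "pcompose P f \<noteq> 0" "pcompose Q f \<noteq> 0" using pcompose_nonzero nz d0 by blast+
  have e0: "e a > 0" for a
  proof -
    have "f - [:poly f a:] \<noteq> 0" using d0 by (metis degree_pCons_0 eq_iff_diff_eq_0 less_numeral_extra(3))
    then show ?thesis unfolding e_def by (simp add: order_gt_0_iff)
  qed
  have lin: "order a [:c, 1:] = (if a = -c then 1 else 0)" for a c :: complex
  proof (cases "a = -c")
    case True
    then show ?thesis using order_power_n_n[of a 1] by simp
  next
    case False
    then show ?thesis by (auto intro!: order_0I simp: add_eq_0_iff)
  qed
  have o_eq: "o' a = int (e a) * o' (poly f a) + (if a = -1 then int k else 0) - (if a = 0 then int k else 0)" for a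
  proof -
    have "order a (Q * pcompose P f * [:1, 1:] ^ k) = order a (pcompose Q f * [:0, 1:] ^ k * P)"
      by (simp only: eq)
    then have "order a Q + order (poly f a) P * e a + k * order a [:1, 1:]
       = order (poly f a) Q * e a + k * order a [:0, 1:] + order a P"
      using nz nzf by (simp add: order_mult order_power order_pcompose d0 e_def)
    then have "int (order a Q + order (poly f a) P * e a + k * order a [:1, 1:])
       = int (order (poly f a) Q * e a + k * order a [:0, 1:] + order a P)" by (rule arg_cong)
    then show ?thesis unfolding o'_def by (simp add: lin algebra_simps split: if_splits)
  qed
  \<comment> \<open>Comparing degrees shows that \<open>P / Q\<close> has neither zero nor pole at
    infinity, so its orders at finite points sum to zero.\<close>
  have "degree (Q * pcompose P f * [:1, 1:] ^ k) = degree (pcompose Q f * [:0, 1:] ^ k * P)"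
    by (simp only: eq)
  then have "degree Q + degree P * degree f = degree Q * degree f + degree P"
    using nz nzf by (simp add: degree_mult_eq degree_power_eq degree_pcompose)
  then have "(int (degree P) - int (degree Q)) * (int (degree f) - 1) = 0"
    by (simp add: algebra_simps flip: of_nat_mult of_nat_add)
  then have degs: "degree P = degree Q" using d by simp
  define U where "U = {a. poly P a = 0} \<union> {a. poly Q a = 0}"
  have finU: "finite U" unfolding U_def using nz by (simp add: poly_roots_finite)
  have SU: "S \<subseteq> U" unfolding S_def U_def o'_def using order_root[of P] order_root[of Q] by fastforce
  have finS: "finite S" using SU finU by (rule finite_subset)
  have sumU: "(\<Sum>a\<in>U. order a p) = degree p" if "p \<noteq> 0" "{a. poly p a = 0} \<subseteq> U" for p
    using that finU by (subst sum_order_complex[symmetric]) (auto intro!: sum.mono_neutral_right order_0I)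
  have "(\<Sum>a\<in>S. o' a) = (\<Sum>a\<in>U. o' a)"
    using finU SU by (intro sum.mono_neutral_left) (auto simp: S_def)
  also have "\<dots> = int (\<Sum>a\<in>U. order a P) - int (\<Sum>a\<in>U. order a Q)"
    by (simp add: o'_def sum_subtractf)
  also have "\<dots> = 0" using nz by (subst (1 2) sumU) (auto simp: U_def degs)
  finally have sum0: "(\<Sum>a\<in>S. o' a) = 0" .
  have "S \<noteq> {}"
  proof
    assume "S = {}"
    then have "o' a = 0" for a by (auto simp: S_def)
    then show False using o_eq[of 0] k by simp
  qed
  then have card0: "card S \<noteq> 0" using finS by simp
  have card1: "card S \<noteq> 1"
  proof
    assume "card S = 1"
    then obtain s where "S = {s}" by (auto simp: card_1_singleton_iff)
    then show False using sum0 by (auto simp: S_def)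
  qed
  \<comment> \<open>Away from 0 and \<open>-1\<close>, \<open>o' a\<close> is a positive multiple of
    \<open>o' (poly f a)\<close>.\<close>
  have sub: "{a. poly f a \<in> S} \<subseteq> S \<union> {0, -1}"
  proof
    fix a assume "a \<in> {a. poly f a \<in> S}"
    then show "a \<in> S \<union> {0, -1}" using o_eq[of a] e0[of a] by (auto simp: S_def)
  qed
  have le: "degree f * card S \<le> card {a. poly f a \<in> S} + (degree f - 1)"
    by (rule card_preimage_ge[OF finS d0])
  have "card {a. poly f a \<in> S} \<le> card (S \<union> {0, -1})" using finS sub by (intro card_mono) auto
  also have "\<dots> \<le> card S + card {0 :: complex, -1}" by (rule card_Un_le)
  finally have c2: "card {a. poly f a \<in> S} \<le> card S + 2" by simp
  have eqS: "card {a. poly f a \<in> S} = card S + 2"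
  proof -
    define n where "n = card S - 2"
    define m where "m = degree f - 3"
    have n: "card S = n + 2" and m: "degree f = m + 3" using card0 card1 d by (auto simp: n_def m_def)
    have "(m + 3) * (n + 2) \<le> card {a. poly f a \<in> S} + (m + 2)" using le unfolding n m by simp
    \<comment> \<open>The upper bound is \<open>n + 4\<close>, so both bounds agree and
      \<open>m = n = 0\<close>.\<close>
    then have "m * n + m + 3 * n + 4 \<le> card {a. poly f a \<in> S}" by (simp add: algebra_simps)
    then show ?thesis using c2 unfolding n by linarith
  qed
  then have "card (S \<union> {0, -1}) \<ge> card S + 2"
    using card_mono[OF _ sub] finS by simp
  then have "card (S \<union> {0, -1}) = card S + card {0 :: complex, -1}"
    using card_Un_le[of S "{0, -1}"] by simp
  then have disj: "S \<inter> {0, -1} = {}"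
    using card_Un_Int[OF finS, of "{0, -1}"] finS by simp
  have "{a. poly f a \<in> S} = S \<union> {0, -1}"
    using sub finS eqS \<open>card (S \<union> {0, -1}) = _\<close> by (intro card_subset_eq) auto
  then have "poly f 0 \<in> S" "poly f (-1) \<in> S" by auto
  then show False using f01 disj by auto
qed

text \<open>Counting zeros needs an algebraically closed field, so the identity is moved to the
  complex numbers.\<close>

lemma no_rational_solution:
  fixes f P Q :: "int poly"
  assumes "degree f \<ge> 3"
    and "poly f 0 \<in> {0, -1} \<or> poly f (-1) \<in> {0, -1}"
    and nz: "P \<noteq> 0" "Q \<noteq> 0" and "k \<ge> 1"
    and eq: "Q * pcompose P f * [:1, 1:] ^ k = pcompose Q f * [:0, 1:] ^ k * P"
  shows False
proof -
  have "of_int_poly (Q * pcompose P f * [:1, 1:] ^ k) = (of_int_poly (pcompose Q f * [:0, 1:] ^ k * P) :: complex poly)"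
    by (simp only: eq)
  then have "of_int_poly Q * pcompose (of_int_poly P) (of_int_poly f) * [:1, 1:] ^ k
      = pcompose (of_int_poly Q) (of_int_poly f) * [:0, 1:] ^ k * (of_int_poly P :: complex poly)"
    by (simp add: of_int_poly_mult of_int_poly_power of_int_poly_pcompose map_poly_pCons)
  moreover have "poly (of_int_poly f) 0 = complex_of_int (poly f 0)" 
    "poly (of_int_poly f) (-1) = complex_of_int (poly f (-1))"
    by (induction f) (simp_all add: map_poly_pCons)
  moreover have "of_int_poly P \<noteq> (0 :: complex poly)" "of_int_poly Q \<noteq> (0 :: complex poly)"
    using nz by (simp_all add: map_poly_eq_0_iff)
  ultimately show False
    using assms(1,2,5) by (intro no_rational_solution_complex[of "of_int_poly f" "of_int_poly P" "of_int_poly Q" k])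
      (auto simp: degree_map_poly)
qed

text \<open>Each form is a multiple of \<open>x * (x + 1)\<close> plus a remainder of degree at most
  one, which gives the values at 0 and \<open>-1\<close>. The fifth form sends \<open>-1\<close> to
  0 and the seventh fixes \<open>-1\<close>; the other five send 0 to 0 or
  \<open>-1\<close>.\<close>

lemma admissible_form_exceptional_point:
  assumes "admissible_form f"
  shows "poly f 0 \<in> {0, -1} \<or> poly f (-1) \<in> {0, -1}"
  using assms by (auto simp: admissible_form_def Let_def)

lemma of_int_poly_eval: "poly (of_int_poly p) (of_int x) = (of_int (poly p x) :: 'a::comm_ring_1)"
  by (induction p) (simp_all add: map_poly_pCons)

section \<open>Orders of growth along an orbit\<close>

text \<open>The recurrence and the limit 1 together determine \<open>\<phi>\<close> as the tails of
  the product. Divergence of \<open>X\<close> is in absolute value, which is the scale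
  \<open>Y\<close> of all estimates below.\<close>

locale mahler_orbit =
  fixes f :: "int poly" and X :: "nat \<Rightarrow> int" and \<phi> :: "nat \<Rightarrow> real"
  assumes degree_f: "degree f \<ge> 3"
    and exceptional_point: "poly f 0 \<in> {0, -1} \<or> poly f (-1) \<in> {0, -1}"
    and orbit: "\<And>n. X (Suc n) = poly f (X n)"
    and X_nonzero: "\<And>n. X n \<noteq> 0"
    and X_unbounded: "filterlim (\<lambda>n. real_of_int (X n)) at_infinity sequentially"
    and \<phi>_Suc: "\<And>n. \<phi> n = (1 + 1 / real_of_int (X n)) * \<phi> (Suc n)"
    and \<phi>_tendsto: "\<phi> \<longlonglongrightarrow> 1"
begin

definition Y :: "nat \<Rightarrow> real" where "Y n = \<bar>real_of_int (X n)\<bar>"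

text \<open>Integer exponents treat growth and decay alike, and orders add under
  multiplication.\<close>

definition ord_le :: "int \<Rightarrow> (nat \<Rightarrow> real) \<Rightarrow> bool" where
  "ord_le m e \<longleftrightarrow> e \<in> O(\<lambda>n. Y n powi m)"

lemma Y_pos: "Y n > 0" using X_nonzero by (simp add: Y_def)

lemma Y_at_top: "filterlim Y at_top sequentially"
  using filterlim_at_infinity_imp_norm_at_top[OF X_unbounded] unfolding Y_def by simp

lemma eventually_Y_ge: "eventually (\<lambda>n. Y n \<ge> B) sequentially"
  using Y_at_top by (simp add: filterlim_at_top)

lemma ord_le_mult:
  assumes "ord_le a u" "ord_le b v"
  shows "ord_le (a + b) (\<lambda>n. u n * v n)"
proof -
  have "(\<lambda>n. u n * v n) \<in> O(\<lambda>n. Y n powi a * Y n powi b)"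
    using assms unfolding ord_le_def by (rule landau_o.big.mult)
  also have "(\<lambda>n. Y n powi a * Y n powi b) = (\<lambda>n. Y n powi (a + b))"
    using Y_pos by (simp add: power_int_add less_imp_neq[symmetric])
  finally show ?thesis unfolding ord_le_def .
qed

lemma ord_le_mono:
  assumes "ord_le a u" "a \<le> b"
  shows "ord_le b u"
proof -
  have "(\<lambda>n. Y n powi a) \<in> O(\<lambda>n. Y n powi b)"
  proof (rule landau_o.big_mono)
    show "eventually (\<lambda>n. norm (Y n powi a) \<le> norm (Y n powi b)) sequentially"
      using eventually_Y_ge[of 1]
      by eventually_elim (use assms(2) in \<open>simp add: power_int_increasing\<close>)
  qed
  then show ?thesis using assms(1) unfolding ord_le_def by (rule landau_o.big_trans[rotated])
qed

lemma ord_le_add: "ord_le a u \<Longrightarrow> ord_le a v \<Longrightarrow> ord_le a (\<lambda>n. u n + v n)"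
  unfolding ord_le_def by (rule sum_in_bigo)

lemma ord_le_diff: "ord_le a u \<Longrightarrow> ord_le a v \<Longrightarrow> ord_le a (\<lambda>n. u n - v n)"
  unfolding ord_le_def by (rule sum_in_bigo)

lemma ord_le_sum: "(\<And>i. i \<in> I \<Longrightarrow> ord_le a (u i)) \<Longrightarrow> ord_le a (\<lambda>n. \<Sum>i\<in>I. u i n)"
  unfolding ord_le_def by (rule big_sum_in_bigo)

lemma ord_le_tendsto: "u \<longlonglongrightarrow> c \<Longrightarrow> ord_le 0 u"
  unfolding ord_le_def by (auto intro!: bigoI_tendsto[of _ _ c])

lemma ord_le_const: "ord_le 0 (\<lambda>_. c)"
  by (rule ord_le_tendsto[OF tendsto_const])

lemma ord_le_power: "ord_le a u \<Longrightarrow> ord_le (int k * a) (\<lambda>n. u n ^ k)"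
proof (induction k)
  case 0
  show ?case using ord_le_const[of 1] by simp
next
  case (Suc k)
  then show ?case using ord_le_mult[of a u "int k * a" "\<lambda>n. u n ^ k"] by (simp add: algebra_simps)
qed

lemma ord_le_X: "ord_le 1 (\<lambda>n. real_of_int (X n))"
  unfolding ord_le_def by (rule landau_o.big_mono) (simp add: Y_def)

lemma ord_le_eventually:
  assumes "eventually (\<lambda>n. \<bar>u n\<bar> \<le> c * Y n powi m) sequentially"
  shows "ord_le m u"
  unfolding ord_le_def
proof (rule bigoI[of _ c])
  show "eventually (\<lambda>n. norm (u n) \<le> c * norm (Y n powi m)) sequentially"
    using assms by eventually_elim (use Y_pos in \<open>simp add: power_int_def less_imp_le\<close>)
qed

lemma ord_leE:
  assumes "ord_le m u"
  obtains c where "c > 0" "eventually (\<lambda>n. \<bar>u n\<bar> \<le> c * Y n powi m) sequentially"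
proof -
  obtain c where c: "c > 0" "eventually (\<lambda>n. norm (u n) \<le> c * norm (Y n powi m)) sequentially"
    using assms unfolding ord_le_def by (auto elim: landau_o.bigE)
  show ?thesis
  proof (rule that[OF c(1)])
    show "eventually (\<lambda>n. \<bar>u n\<bar> \<le> c * Y n powi m) sequentially"
      using c(2) by eventually_elim (use Y_pos in \<open>simp add: power_int_def less_imp_le\<close>)
  qed
qed

text \<open>Otherwise \<open>c * Y n \<le> C\<close> for all large \<open>n\<close>, although
  \<open>Y\<close> is unbounded. Upper and lower bounds are confronted through this lemma.\<close>

lemma ord_le_imp_exponent_le:
  assumes "ord_le b u" "c > 0" "eventually (\<lambda>n. c * Y n powi a \<le> \<bar>u n\<bar>) sequentially"
  shows "a \<le> b"
proof (rule ccontr)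
  assume "\<not> a \<le> b"
  then have ab: "b + 1 \<le> a" by simp
  obtain C where C: "C > 0" "eventually (\<lambda>n. \<bar>u n\<bar> \<le> C * Y n powi b) sequentially"
    using assms(1) by (rule ord_leE)
  have "eventually (\<lambda>n. False) sequentially"
    using assms(3) C(2) eventually_Y_ge[of 1] eventually_Y_ge[of "C / c + 1"]
  proof eventually_elim
    case (elim n)
    have "c * (Y n powi b * Y n) = c * Y n powi (b + 1)" using Y_pos[of n] by (simp add: power_int_add)
    also have "\<dots> \<le> c * Y n powi a" using elim ab assms(2) by (intro mult_left_mono power_int_increasing) auto
    also have "\<dots> \<le> C * Y n powi b" using elim by linarith
    finally have "(c * Y n) * Y n powi b \<le> C * Y n powi b" by (simp add: mult_ac)
    then have "c * Y n \<le> C" using zero_less_power_int[OF Y_pos[of n], of b] by (simp add: mult_le_cancel_right)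
    moreover have "C < c * Y n" using elim assms(2) by (simp add: field_simps)
    ultimately show False by simp
  qed
  then show False by simp
qed

lemma ord_le_poly:
  assumes "degree p \<le> m"
  shows "ord_le (int m) (\<lambda>n. real_of_int (poly p (X n)))"
proof -
  have "real_of_int (poly p (X n)) = (\<Sum>i\<le>degree p. real_of_int (coeff p i) * real_of_int (X n) ^ i)" for n
    by (simp add: poly_altdef)
  moreover have "ord_le (int m) (\<lambda>n. real_of_int (coeff p i) * real_of_int (X n) ^ i)" if "i \<le> degree p" for i
    using ord_le_mult[OF ord_le_const ord_le_power[OF ord_le_X, of i], of "real_of_int (coeff p i)"] that assms
    by (elim ord_le_mono) auto
  ultimately show ?thesis by (auto intro!: ord_le_sum)
qed

lemma poly_lower_bound:
  assumes "p \<noteq> 0"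
  obtains c where "c > 0" "eventually (\<lambda>n. c * Y n ^ degree p \<le> \<bar>real_of_int (poly p (X n))\<bar>) sequentially"
proof -
  let ?p = "of_int_poly p :: real poly"
  \<comment> \<open>Half of the limit of \<open>\<bar>p(x) / x ^ degree p\<bar>\<close> is
    eventually a lower bound.\<close>
  define c where "c = \<bar>lead_coeff ?p\<bar> / 2"
  have deg: "degree ?p = degree p" by (simp add: degree_map_poly)
  have "lead_coeff ?p \<noteq> 0" using assms by (simp add: map_poly_eq_0_iff)
  then have c: "c > 0" by (simp add: c_def)
  have "((\<lambda>x. poly ?p x / x ^ degree ?p) \<longlongrightarrow> lead_coeff ?p) at_infinity"
    by (rule poly_divide_tendsto_aux)
  then have "(\<lambda>n. poly ?p (real_of_int (X n)) / real_of_int (X n) ^ degree ?p) \<longlonglongrightarrow> lead_coeff ?p"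
    by (rule filterlim_compose[OF _ X_unbounded])
  then have "(\<lambda>n. \<bar>poly ?p (real_of_int (X n)) / real_of_int (X n) ^ degree ?p\<bar>) \<longlonglongrightarrow> \<bar>lead_coeff ?p\<bar>"
    by (rule tendsto_rabs)
  moreover have "c < \<bar>lead_coeff ?p\<bar>" using c by (simp add: c_def)
  ultimately have "eventually (\<lambda>n. c < \<bar>poly ?p (real_of_int (X n)) / real_of_int (X n) ^ degree ?p\<bar>) sequentially"
    by (rule order_tendstoD)
  then have "eventually (\<lambda>n. c * Y n ^ degree p \<le> \<bar>real_of_int (poly p (X n))\<bar>) sequentially"
  proof eventually_elim
    case (elim n)
    then have "c < \<bar>real_of_int (poly p (X n))\<bar> / Y n ^ degree p"
      by (simp add: of_int_poly_eval deg Y_def power_abs abs_divide)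
    then show ?case using Y_pos[of n] by (simp add: field_simps)
  qed
  with c show ?thesis by (rule that)
qed

lemma poly_inverse_ord_le:
  assumes "p \<noteq> 0"
  shows "ord_le (- int (degree p)) (\<lambda>n. inverse (real_of_int (poly p (X n))))"
proof -
  obtain c where c: "c > 0" "eventually (\<lambda>n. c * Y n ^ degree p \<le> \<bar>real_of_int (poly p (X n))\<bar>) sequentially"
    using poly_lower_bound[OF assms] by blast
  show ?thesis
  proof (rule ord_le_eventually[of _ "inverse c"])
    show "eventually (\<lambda>n. \<bar>inverse (real_of_int (poly p (X n)))\<bar> \<le> inverse c * Y n powi - int (degree p)) sequentially"
      using c(2)
    proof eventually_elim
      case (elim n)
      have "0 < c * Y n ^ degree p" using c(1) Y_pos[of n] by simp
      with elim have "inverse \<bar>real_of_int (poly p (X n))\<bar> \<le> inverse (c * Y n ^ degree p)"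
        by (rule le_imp_inverse_le)
      then show ?case by (simp add: abs_inverse power_int_minus)
    qed
  qed
qed

text \<open>Growth is at least cubic; one factor \<open>Y n \<ge> 4 / c\<close> absorbs the unknown
  constant \<open>c\<close> and leaves a square.\<close>

lemma growth: "eventually (\<lambda>n. Y n \<ge> 2 \<and> 4 * Y n ^ 2 \<le> Y (Suc n)) sequentially"
proof -
  have "f \<noteq> 0" using degree_f by auto
  then obtain c where c: "c > 0" "eventually (\<lambda>n. c * Y n ^ degree f \<le> \<bar>real_of_int (poly f (X n))\<bar>) sequentially"
    using poly_lower_bound by blast
  show ?thesis
    using c(2) eventually_Y_ge[of 2] eventually_Y_ge[of "4 / c"]
  proof eventually_elim
    case (elim n)
    have "4 * Y n ^ 2 \<le> (c * Y n) * Y n ^ 2"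
      using elim c(1) by (intro mult_right_mono) (auto simp: field_simps)
    also have "\<dots> = c * Y n ^ 3" by (simp add: power_numeral_reduce)
    also have "\<dots> \<le> c * Y n ^ degree f"
      using elim c(1) degree_f by (intro mult_left_mono power_increasing) auto
    also have "\<dots> \<le> Y (Suc n)" using elim by (simp add: Y_def orbit)
    finally show ?case using elim by simp
  qed
qed

section \<open>Sequences smaller than every power of the orbit\<close>

definition flat :: "(nat \<Rightarrow> real) \<Rightarrow> bool" where
  "flat u \<longleftrightarrow> (\<forall>m. ord_le m u)"

lemma flat_mult: "flat u \<Longrightarrow> ord_le a v \<Longrightarrow> flat (\<lambda>n. v n * u n)"
  unfolding flat_def by (metis ord_le_mult add.commute diff_add_cancel)

lemma flat_diff: "flat u \<Longrightarrow> flat v \<Longrightarrow> flat (\<lambda>n. u n - v n)"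
  unfolding flat_def by (simp add: ord_le_diff)

lemma flat_Suc:
  assumes "flat u"
  shows "flat (\<lambda>n. u (Suc n))"
  unfolding flat_def
proof
  fix m :: int
  \<comment> \<open>A negative exponent reverses \<open>Y n \<le> Y (Suc n)\<close> into the
    inequality needed.\<close>
  define b where "b = min m (- 1)"
  have "ord_le b u" using assms by (simp add: flat_def)
  then obtain c where c: "c > 0" "eventually (\<lambda>n. \<bar>u n\<bar> \<le> c * Y n powi b) sequentially" by (rule ord_leE)
  have "eventually (\<lambda>n. \<bar>u (Suc n)\<bar> \<le> c * Y (Suc n) powi b) sequentially"
    using c(2) by (rule eventually_sequentially_Suc[THEN iffD2])
  then have "eventually (\<lambda>n. \<bar>u (Suc n)\<bar> \<le> c * Y n powi b) sequentially"
    using growth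
  proof eventually_elim
    case (elim n)
    have "Y n * 1 \<le> Y n * (4 * Y n)" using elim by (intro mult_left_mono) auto
    then have "Y n \<le> 4 * Y n ^ 2" by (simp add: power2_eq_square)
    then have "Y (Suc n) powi b \<le> Y n powi b"
      using elim Y_pos[of n] by (intro power_int_antimono) (auto simp: b_def)
    then show ?case using elim(1) c(1) by (meson mult_left_mono less_imp_le order_trans)
  qed
  then have "ord_le b (\<lambda>n. u (Suc n))" by (rule ord_le_eventually)
  then show "ord_le m (\<lambda>n. u (Suc n))" by (rule ord_le_mono) (simp add: b_def)
qed

lemma flat_poly_imp_0:
  assumes "flat (\<lambda>n. real_of_int (poly p (X n)))"
  shows "p = 0"
proof (rule ccontr)
  assume "p \<noteq> 0"
  then obtain c where c: "c > 0" "eventually (\<lambda>n. c * Y n ^ degree p \<le> \<bar>real_of_int (poly p (X n))\<bar>) sequentially"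
    using poly_lower_bound by blast
  then have "int (degree p) \<le> int (degree p) - 1"
    using assms unfolding flat_def by (intro ord_le_imp_exponent_le[OF _ c(1)]) auto
  then show False by simp
qed

section \<open>Approximation of the tails by finite products\<close>

lemma \<phi>_eventually_nonzero: "eventually (\<lambda>n. \<phi> n \<noteq> 0) sequentially"
  using \<phi>_tendsto by (rule tendsto_imp_eventually_ne) simp

definition \<rho> :: "nat \<Rightarrow> nat \<Rightarrow> real" where
  "\<rho> J n = (\<Prod>j<J. 1 + 1 / real_of_int (X (n + j)))"

lemma \<rho>_Suc: "\<rho> (Suc J) n = (1 + 1 / real_of_int (X n)) * \<rho> J (Suc n)"
  unfolding \<rho>_def by (subst prod.lessThan_Suc_shift) simp

lemma \<phi>_eq_\<rho>: "\<phi> n = \<rho> J n * \<phi> (n + J)"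
proof (induction J arbitrary: n)
  case (Suc J)
  show ?case using \<phi>_Suc[of n] Suc[of "Suc n"] by (simp add: \<rho>_Suc)
qed (simp add: \<rho>_def)

text \<open>The first factor is at most 2 in absolute value and differs from 1 by
  \<open>1 / Y n\<close>; the remaining product differs from 1 by at most
  \<open>4 / Y (Suc n) \<le> 1 / Y n\<close>. The total \<open>3 / Y n\<close> stays below the
  bound, which is therefore uniform in \<open>J\<close>.\<close>

lemma \<rho>_near_1:
  assumes "\<And>i. i \<ge> n \<Longrightarrow> Y i \<ge> 2 \<and> 4 * Y i ^ 2 \<le> Y (Suc i)"
  shows "\<bar>\<rho> J n - 1\<bar> \<le> 4 / Y n"
  using assms
proof (induction J arbitrary: n)
  case 0
  then show ?case using Y_pos[of n] by (simp add: \<rho>_def)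
next
  case (Suc J)
  define x where "x = real_of_int (X n)"
  have Yx: "Y n = \<bar>x\<bar>" by (simp add: Y_def x_def)
  have n: "Y n \<ge> 2" "4 * Y n ^ 2 \<le> Y (Suc n)" using Suc.prems[of n] by auto
  have IH: "\<bar>\<rho> J (Suc n) - 1\<bar> \<le> 4 / Y (Suc n)" using Suc by simp
  have "Y n * 1 \<le> Y n * Y n" using n by (intro mult_left_mono) auto
  then have n2: "4 * Y n \<le> Y (Suc n)" using n(2) unfolding power2_eq_square by linarith
  have "4 / Y (Suc n) \<le> 4 / (4 * Y n)" using n n2 Y_pos[of n] by (intro divide_left_mono) auto
  then have a: "\<bar>\<rho> J (Suc n) - 1\<bar> \<le> 1 / Y n" using IH by simp
  have i: "\<bar>1 / x\<bar> = 1 / Y n" by (simp add: Yx)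
  have h: "1 / Y n \<le> 1 / 2" using n by (intro divide_left_mono) auto
  have "\<rho> (Suc J) n - 1 = (1 + 1 / x) * (\<rho> J (Suc n) - 1) + 1 / x"
    by (simp add: \<rho>_Suc x_def algebra_simps)
  then have "\<bar>\<rho> (Suc J) n - 1\<bar> \<le> \<bar>1 + 1 / x\<bar> * \<bar>\<rho> J (Suc n) - 1\<bar> + \<bar>1 / x\<bar>"
    by (metis abs_mult abs_triangle_ineq)
  also have "\<dots> \<le> 2 * (1 / Y n) + 1 / Y n"
  proof (intro add_mono mult_mono)
    show "\<bar>1 + 1 / x\<bar> \<le> 2" using h i by linarith
  qed (use a i in auto)
  also have "\<dots> \<le> 4 / Y n" using Y_pos[of n] by (simp add: field_simps)
  finally show ?case .
qed

text \<open>The bound for \<open>\<rho> J n\<close> is uniform in \<open>J\<close> and passes to the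
  limit \<open>\<phi> n\<close>.\<close>

lemma \<phi>_near_1: "eventually (\<lambda>n. \<bar>\<phi> n - 1\<bar> \<le> 4 / Y n) sequentially"
proof -
  obtain n0 where n0: "\<And>i. i \<ge> n0 \<Longrightarrow> Y i \<ge> 2 \<and> 4 * Y i ^ 2 \<le> Y (Suc i)"
    using growth unfolding eventually_sequentially by blast
  have "\<bar>\<phi> n - 1\<bar> \<le> 4 / Y n" if "n \<ge> n0" for n
  proof -
    have lim: "(\<lambda>J. \<phi> (n + J)) \<longlonglongrightarrow> 1"
      using LIMSEQ_ignore_initial_segment[OF \<phi>_tendsto, of n] by (simp add: add.commute)
    then have "(\<lambda>J. \<phi> n / \<phi> (n + J)) \<longlonglongrightarrow> \<phi> n / 1"
      by (intro tendsto_intros) auto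
    moreover have "eventually (\<lambda>J. \<phi> n / \<phi> (n + J) = \<rho> J n) sequentially"
      using tendsto_imp_eventually_ne[OF lim, of 0]
      by (auto elim!: eventually_mono simp: \<phi>_eq_\<rho>[of n, symmetric] nonzero_divide_eq_eq)
    ultimately have "(\<lambda>J. \<rho> J n) \<longlonglongrightarrow> \<phi> n" by (simp add: filterlim_cong)
    then have "(\<lambda>J. \<bar>\<rho> J n - 1\<bar>) \<longlonglongrightarrow> \<bar>\<phi> n - 1\<bar>" by (intro tendsto_intros)
    then show ?thesis
      by (rule LIMSEQ_le_const2) (use \<rho>_near_1[of n] n0 that in auto)
  qed
  then show ?thesis unfolding eventually_sequentially by blast
qed

lemma \<rho>_tendsto: "(\<lambda>n. \<rho> J n) \<longlonglongrightarrow> 1"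
proof -
  have "(\<lambda>n. inverse (real_of_int (X n))) \<longlonglongrightarrow> 0"
    by (rule filterlim_compose[OF tendsto_inverse_0 X_unbounded])
  then have "(\<lambda>n. inverse (real_of_int (X (n + j)))) \<longlonglongrightarrow> 0" for j
    by (rule LIMSEQ_ignore_initial_segment)
  then have "(\<lambda>n. 1 + inverse (real_of_int (X (n + j)))) \<longlonglongrightarrow> 1 + 0" for j
    by (intro tendsto_intros)
  then have "(\<lambda>n. \<Prod>j<J. 1 + inverse (real_of_int (X (n + j)))) \<longlonglongrightarrow> (\<Prod>j<J. 1 + 0)"
    by (intro tendsto_prod)
  then show ?thesis by (simp add: \<rho>_def[abs_def] divide_inverse)
qed

lemma iterate_growth:
  assumes "\<And>i. i \<ge> n \<Longrightarrow> Y i \<ge> 2 \<and> 4 * Y i ^ 2 \<le> Y (Suc i)"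
  shows "Y n ^ Suc J \<le> Y (n + J)"
proof (induction J)
  case (Suc J)
  have g: "Y (n + J) \<ge> 2" "4 * Y (n + J) ^ 2 \<le> Y (Suc (n + J))" "Y n \<ge> 2" using assms by auto
  have "Y n ^ 1 \<le> Y n ^ Suc J" using g(3) by (intro power_increasing) auto
  then have "Y n \<le> Y (n + J)" using Suc by simp
  then have "Y n * Y n ^ Suc J \<le> Y (n + J) * Y (n + J)"
    using Suc Y_pos[of n] Y_pos[of "n + J"] by (intro mult_mono) auto
  also have "\<dots> \<le> 4 * Y (n + J) ^ 2" by (simp add: power2_eq_square)
  finally show ?case using g(2) by simp
qed simp

text \<open>The difference is \<open>\<rho> J n * (\<phi> (n + J) - 1)\<close>. Its second factor is
  of order \<open>1 / Y (n + J)\<close>, and \<open>J\<close> steps of the orbit gain at least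
  \<open>J\<close> powers of \<open>Y n\<close>.\<close>

lemma ord_le_\<phi>_minus_\<rho>: "ord_le (- int J) (\<lambda>n. \<phi> n - \<rho> J n)"
proof -
  obtain n0 where n0: "\<And>i. i \<ge> n0 \<Longrightarrow> Y i \<ge> 2 \<and> 4 * Y i ^ 2 \<le> Y (Suc i)"
    using growth unfolding eventually_sequentially by blast
  obtain n1 where n1: "\<And>i. i \<ge> n1 \<Longrightarrow> \<bar>\<phi> i - 1\<bar> \<le> 4 / Y i"
    using \<phi>_near_1 unfolding eventually_sequentially by blast
  have "\<bar>\<phi> (n + J) - 1\<bar> \<le> 4 * Y n powi (- int J)" if "n \<ge> max n0 n1" for n
  proof -
    have Y2: "Y n \<ge> 2" using n0 that by simp
    have "\<bar>\<phi> (n + J) - 1\<bar> \<le> 4 / Y (n + J)" using n1 that by simp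
    also have "\<dots> \<le> 4 / Y n ^ J"
    proof (rule divide_left_mono)
      have "Y n ^ J \<le> Y n ^ Suc J" using Y2 by (intro power_increasing) auto
      also have "\<dots> \<le> Y (n + J)" using n0 that by (intro iterate_growth) simp
      finally show "Y n ^ J \<le> Y (n + J)" .
    qed (use Y_pos in auto)
    finally show ?thesis by (simp add: power_int_minus divide_inverse)
  qed
  then have "ord_le (- int J) (\<lambda>n. \<phi> (n + J) - 1)"
    by (intro ord_le_eventually[of _ 4]) (auto simp: eventually_sequentially intro!: exI[of _ "max n0 n1"])
  then have "ord_le (- int J) (\<lambda>n. \<rho> J n * (\<phi> (n + J) - 1))"
    using ord_le_mult[OF ord_le_tendsto[OF \<rho>_tendsto[of J]]] by fastforce
  moreover have "\<rho> J n * (\<phi> (n + J) - 1) = \<phi> n - \<rho> J n" for n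
    using \<phi>_eq_\<rho>[of n J] by (simp add: algebra_simps)
  ultimately show ?thesis by simp
qed

section \<open>The finite products as quotients of polynomials in the orbit\<close>

definition iter_poly :: "nat \<Rightarrow> int poly" where
  "iter_poly j = (pcompose f ^^ j) [:0, 1:]"

definition num :: "nat \<Rightarrow> int poly" where "num J = (\<Prod>j<J. iter_poly j + 1)"

definition den :: "nat \<Rightarrow> int poly" where "den J = (\<Prod>j<J. iter_poly j)"

lemma poly_iter_poly: "poly (iter_poly j) (X n) = X (n + j)"
  by (induction j) (simp_all add: iter_poly_def poly_pcompose orbit)

lemma degree_iter_poly: "degree (iter_poly j) > 0"
  using degree_f by (induction j) (simp_all add: iter_poly_def degree_pcompose)

lemma iter_poly_nonzero: "iter_poly j \<noteq> 0"
  using degree_iter_poly[of j] by auto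

lemma degree_iter_poly_add_1: "degree (iter_poly j + 1) = degree (iter_poly j)"
  using degree_iter_poly[of j] by (intro degree_add_eq_left) simp

lemma degree_den: "degree (den J) = (\<Sum>j<J. degree (iter_poly j))"
  unfolding den_def using iter_poly_nonzero by (intro degree_prod_sum_eq) auto

lemma degree_num: "degree (num J) = degree (den J)"
proof -
  have "iter_poly j + 1 \<noteq> 0" for j
    using degree_iter_poly[of j] degree_iter_poly_add_1[of j] by auto
  then have "degree (num J) = (\<Sum>j<J. degree (iter_poly j + 1))"
    unfolding num_def by (intro degree_prod_sum_eq) auto
  then show ?thesis by (simp add: degree_den degree_iter_poly_add_1)
qed

lemma degree_den_ge: "J \<le> degree (den J)"
proof -
  have "(\<Sum>j<J. 1) \<le> (\<Sum>j<J. degree (iter_poly j))"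
    using degree_iter_poly by (intro sum_mono) (simp add: Suc_le_eq)
  then show ?thesis by (simp add: degree_den)
qed

lemma poly_den: "poly (den J) (X n) = (\<Prod>j<J. X (n + j))"
  by (simp add: den_def poly_prod poly_iter_poly)

lemma poly_den_nonzero: "poly (den J) (X n) \<noteq> 0"
  using X_nonzero by (simp add: poly_den)

lemma den_nonzero: "den J \<noteq> 0"
  using poly_den_nonzero[of J 0] by auto

lemma \<rho>_eq: "\<rho> J n = real_of_int (poly (num J) (X n)) / real_of_int (poly (den J) (X n))"
proof -
  have "\<rho> J n = (\<Prod>j<J. (real_of_int (X (n + j)) + 1) / real_of_int (X (n + j)))"
    unfolding \<rho>_def using X_nonzero by (intro prod.cong refl) (simp add: field_simps)
  then show ?thesis by (simp add: num_def poly_den poly_prod poly_iter_poly prod_dividef)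
qed

section \<open>The auxiliary function and its eventual non-vanishing\<close>

definition E :: "(nat \<Rightarrow> int poly) \<Rightarrow> nat \<Rightarrow> nat \<Rightarrow> real" where
  "E P k n = (\<Sum>i\<le>k. real_of_int (poly (P i) (X n)) * \<phi> n ^ i)"

definition E\<rho> :: "(nat \<Rightarrow> int poly) \<Rightarrow> nat \<Rightarrow> nat \<Rightarrow> nat \<Rightarrow> real" where
  "E\<rho> P k J n = (\<Sum>i\<le>k. real_of_int (poly (P i) (X n)) * \<rho> J n ^ i)"

text \<open>The form \<open>E\<rho>\<close> with its denominators cleared: a polynomial in
  \<open>X n\<close> alone, whose degree governs the size of \<open>E\<rho>\<close>.\<close>

definition T :: "(nat \<Rightarrow> int poly) \<Rightarrow> nat \<Rightarrow> nat \<Rightarrow> int poly" where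
  "T P k J = (\<Sum>i\<le>k. P i * num J ^ i * den J ^ (k - i))"

lemma poly_T: "real_of_int (poly (T P k J) (X n)) = real_of_int (poly (den J) (X n)) ^ k * E\<rho> P k J n"
proof -
  let ?d = "real_of_int (poly (den J) (X n))" and ?u = "real_of_int (poly (num J) (X n))"
  have d: "?d \<noteq> 0" using poly_den_nonzero by simp
  have "?u ^ i * ?d ^ (k - i) = ?d ^ k * \<rho> J n ^ i" if "i \<le> k" for i
    using that d by (simp add: \<rho>_eq power_divide power_diff)
  then show ?thesis
    unfolding T_def E\<rho>_def by (simp add: poly_sum sum_distrib_left mult_ac)
qed

text \<open>Each \<open>\<phi> n ^ i - \<rho> J n ^ i\<close> is
  \<open>\<phi> n - \<rho> J n\<close> times a bounded factor.\<close>

lemma ord_le_E_minus_E\<rho>: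
  assumes "\<And>i. i \<le> k \<Longrightarrow> degree (P i) \<le> N"
  shows "ord_le (int N - int J) (\<lambda>n. E P k n - E\<rho> P k J n)"
proof -
  have "ord_le (int N - int J) (\<lambda>n. real_of_int (poly (P i) (X n)) * (\<phi> n ^ i - \<rho> J n ^ i))" if "i \<le> k" for i
  proof -
    have 1: "ord_le 0 (\<lambda>n. \<Sum>l<i. \<rho> J n ^ (i - Suc l) * \<phi> n ^ l)"
      by (rule ord_le_tendsto[of _ "\<Sum>l<i. 1 ^ (i - Suc l) * 1 ^ l"])
        (intro tendsto_intros \<rho>_tendsto \<phi>_tendsto)
    show ?thesis
      using ord_le_mult[OF ord_le_poly[OF assms[OF that]] ord_le_mult[OF ord_le_\<phi>_minus_\<rho>[of J] 1]]
      by (simp add: power_diff_sumr2)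
  qed
  then have "ord_le (int N - int J) (\<lambda>n. \<Sum>i\<le>k. real_of_int (poly (P i) (X n)) * (\<phi> n ^ i - \<rho> J n ^ i))"
    by (intro ord_le_sum) auto
  then show ?thesis by (simp add: E_def E\<rho>_def algebra_simps sum_subtractf)
qed

lemma ord_le_E\<rho>:
  assumes "degree (T P k J) \<le> t"
  shows "ord_le (int t - int (k * degree (den J))) (E\<rho> P k J)"
proof -
  have "E\<rho> P k J n = real_of_int (poly (T P k J) (X n)) * inverse (real_of_int (poly (den J) (X n))) ^ k" for n
    using poly_den_nonzero[of J n] by (simp add: poly_T field_simps)
  then have "E\<rho> P k J = (\<lambda>n. real_of_int (poly (T P k J) (X n)) * inverse (real_of_int (poly (den J) (X n))) ^ k)"
    by (rule ext)
  then show ?thesis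
    using ord_le_mult[OF ord_le_poly[OF assms] ord_le_power[OF poly_inverse_ord_le[OF den_nonzero[of J]], of k]]
    by simp
qed

text \<open>For large \<open>J\<close> the error \<open>E - E\<rho>\<close> has order at most
  \<open>m - 1\<close>. The rational function \<open>E\<rho>\<close> either has order at most
  \<open>m\<close>, and so has \<open>E\<close>, or it dominates the error and \<open>E\<close> is
  eventually nonzero. As \<open>m\<close> is arbitrary, \<open>E\<close> is eventually nonzero or
  flat.\<close>

lemma E_eventually_nonzero_or_ord_le:
  "eventually (\<lambda>n. E P k n \<noteq> 0) sequentially \<or> ord_le m (E P k)"
proof -
  define N where "N = (\<Sum>i\<le>k. degree (P i))"
  define J where "J = nat (int N + \<bar>m\<bar> + 1)"
  define \<delta> where "\<delta> = degree (den J)"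
  have N: "degree (P i) \<le> N" if "i \<le> k" for i
    unfolding N_def using that by (intro member_le_sum) auto
  have J: "int N - int J \<le> m - 1" unfolding J_def by linarith
  have diff: "ord_le (m - 1) (\<lambda>n. E P k n - E\<rho> P k J n)"
    using ord_le_E_minus_E\<rho>[OF N] J by (rule ord_le_mono)
  show ?thesis
  proof (cases "T P k J = 0 \<or> int (degree (T P k J)) < int (k * \<delta>) + m")
    case True
    have "ord_le m (E\<rho> P k J)"
    proof (cases "T P k J = 0")
      case True
      then have "E\<rho> P k J n = 0" for n using poly_T[of P k J n] poly_den_nonzero[of J n] by simp
      then have "E\<rho> P k J = (\<lambda>_. 0)" by auto
      then show ?thesis by (simp add: ord_le_def)
    next
      case False
      then show ?thesis using True ord_le_E\<rho>[OF order_refl, of P k J] by (elim ord_le_mono) (auto simp: \<delta>_def)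
    qed
    then have "ord_le m (\<lambda>n. (E P k n - E\<rho> P k J n) + E\<rho> P k J n)"
      using ord_le_mono[OF diff, of m] by (intro ord_le_add) auto
    then show ?thesis by simp
  next
    case False
    then have T: "T P k J \<noteq> 0" "int (k * \<delta>) + m \<le> int (degree (T P k J))" by auto
    obtain c where c: "c > 0"
      "eventually (\<lambda>n. c * Y n ^ degree (T P k J) \<le> \<bar>real_of_int (poly (T P k J) (X n))\<bar>) sequentially"
      using poly_lower_bound[OF T(1)] by blast
    obtain C where C: "C > 0" "eventually (\<lambda>n. \<bar>real_of_int (poly (den J) (X n)) ^ k\<bar> \<le> C * Y n powi (int k * int \<delta>)) sequentially"
      using ord_leE[OF ord_le_power[OF ord_le_poly[of "den J" \<delta>], of k]] by (auto simp: \<delta>_def)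
    obtain B where B: "B > 0" "eventually (\<lambda>n. \<bar>E P k n - E\<rho> P k J n\<bar> \<le> B * Y n powi (m - 1)) sequentially"
      using ord_leE[OF diff] by blast
    have "eventually (\<lambda>n. E P k n \<noteq> 0) sequentially"
      \<comment> \<open>Beyond \<open>B * C / c\<close> the main term, at least
        \<open>c / C * Y n powi m\<close>, exceeds the error
        \<open>B * Y n powi (m - 1)\<close>.\<close>
      using c(2) C(2) B(2) eventually_Y_ge[of 1] eventually_Y_ge[of "B * C / c + 1"]
    proof eventually_elim
      case (elim n)
      have pos: "Y n powi a > 0" for a using Y_pos[of n] by (rule zero_less_power_int)
      have "c * (Y n powi m * Y n powi (int k * int \<delta>)) = c * Y n powi (int (k * \<delta>) + m)"
        using Y_pos[of n] by (simp add: power_int_add)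
      also have "\<dots> \<le> c * Y n powi int (degree (T P k J))"
        using T(2) c(1) elim by (intro mult_left_mono power_int_increasing) auto
      also have "\<dots> \<le> \<bar>real_of_int (poly (den J) (X n)) ^ k\<bar> * \<bar>E\<rho> P k J n\<bar>"
        using elim by (simp add: poly_T abs_mult)
      also have "\<dots> \<le> (C * Y n powi (int k * int \<delta>)) * \<bar>E\<rho> P k J n\<bar>"
        using elim by (intro mult_right_mono) auto
      finally have "(c * Y n powi m) * Y n powi (int k * int \<delta>) \<le> (C * \<bar>E\<rho> P k J n\<bar>) * Y n powi (int k * int \<delta>)"
        by (simp add: mult_ac)
      then have 1: "c * Y n powi m \<le> C * \<bar>E\<rho> P k J n\<bar>" using pos[of "int k * int \<delta>"] by simp
      have "Y n powi m = Y n powi (m - 1) * Y n" using Y_pos[of n] power_int_add[of "Y n" "m - 1" 1] by simp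
      moreover have "B * C < c * Y n" using elim c(1) by (simp add: field_simps)
      ultimately have "C * (B * Y n powi (m - 1)) < c * Y n powi m"
        using pos[of "m - 1"] by (simp add: mult_ac mult_strict_left_mono flip: mult.assoc)
      with 1 have "C * (B * Y n powi (m - 1)) < C * \<bar>E\<rho> P k J n\<bar>" by simp
      then have "B * Y n powi (m - 1) < \<bar>E\<rho> P k J n\<bar>" using C(1) by simp
      then show ?case using elim(3) by auto
    qed
    then show ?thesis ..
  qed
qed

text \<open>
  The combination of \<open>E P K (n + 1)\<close> and \<open>E P K n\<close> in which the powers \<open>\<phi> n ^ K\<close> cancel is again flat
  and of smaller degree in \<open>\<phi>\<close>, so by induction its coefficients \<open>R i\<close> vanish.
\<close>
lemma flat_E_imp_0:
  assumes "flat (E P k)" "i \<le> k"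
  shows "P i = 0"
  using assms
proof (induction k arbitrary: P i)
  case 0
  have "E P 0 = (\<lambda>n. real_of_int (poly (P 0) (X n)))" by (auto simp: E_def)
  then show ?case using 0 flat_poly_imp_0[of "P 0"] by simp
next
  case (Suc k)
  define K where "K = Suc k"
  have flatE: "flat (E P K)" using Suc.prems by (simp add: K_def)
  have PK: "P K = 0"
  proof (rule ccontr)
    assume PK: "P K \<noteq> 0"
    \<comment> \<open>\<open>R i\<close> is the coefficient of \<open>\<phi> n ^ i\<close> in
      \<open>u n * E P K (Suc n) - v n * E P K n\<close>. The power of \<open>1 + x\<close> clears
      the denominator of \<open>\<phi> (Suc n) = x / (1 + x) * \<phi> n\<close>, and
      \<open>R K = 0\<close>.\<close>
    define R where "R i = P K * pcompose (P i) f * [:1, 1:] ^ (K - i) * [:0, 1:] ^ i - pcompose (P K) f * [:0, 1:] ^ K * P i" for i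
    define u where "u n = real_of_int (poly (P K * [:1, 1:] ^ K) (X n))" for n
    define v where "v n = real_of_int (poly (pcompose (P K) f * [:0, 1:] ^ K) (X n))" for n
    have fl: "flat (\<lambda>n. u n * E P K (Suc n) - v n * E P K n)"
      unfolding u_def v_def
      by (intro flat_diff flat_mult[OF flat_Suc[OF flatE] ord_le_poly[OF order_refl]]
            flat_mult[OF flatE ord_le_poly[OF order_refl]])
    have "u n * E P K (Suc n) - v n * E P K n = E R k n" for n
    proof -
      let ?x = "real_of_int (X n)"
      have x: "?x \<noteq> 0" using X_nonzero by simp
      have ph: "?x * \<phi> n = (1 + ?x) * \<phi> (Suc n)" using x by (subst \<phi>_Suc) (simp add: field_simps)
      have e: "(1 + ?x) ^ K * \<phi> (Suc n) ^ i = (1 + ?x) ^ (K - i) * ?x ^ i * \<phi> n ^ i" if "i \<le> K" for i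
      proof -
        have "(1 + ?x) ^ K * \<phi> (Suc n) ^ i = (1 + ?x) ^ (K - i) * ((1 + ?x) * \<phi> (Suc n)) ^ i"
          using that by (simp add: power_mult_distrib flip: power_add mult.assoc)
        then show ?thesis unfolding ph[symmetric] by (simp add: power_mult_distrib)
      qed
      have "u n * E P K (Suc n) = (\<Sum>i\<le>K. real_of_int (poly (P K) (X n)) * real_of_int (poly (P i) (X (Suc n))) * ((1 + ?x) ^ K * \<phi> (Suc n) ^ i))"
        unfolding E_def u_def sum_distrib_left by (intro sum.cong refl) (simp add: mult_ac)
      also have "\<dots> = (\<Sum>i\<le>K. real_of_int (poly (P K) (X n)) * real_of_int (poly (P i) (X (Suc n))) * ((1 + ?x) ^ (K - i) * ?x ^ i * \<phi> n ^ i))"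
        by (intro sum.cong refl) (simp add: e)
      finally have "u n * E P K (Suc n) - v n * E P K n = (\<Sum>i\<le>K. real_of_int (poly (R i) (X n)) * \<phi> n ^ i)"
        unfolding E_def v_def sum_distrib_left
        by (simp add: R_def orbit poly_pcompose algebra_simps flip: sum_subtractf)
      also have "\<dots> = E R k n" unfolding E_def K_def by (simp add: R_def K_def)
      finally show ?thesis .
    qed
    then have "flat (E R k)" using fl by simp
    then have R0: "R i = 0" if "i \<le> k" for i using Suc.IH that by blast
    \<comment> \<open>A nonzero \<open>P i\<close> would make \<open>P i / P K\<close> a rational
      solution of the functional equation with exponent \<open>K - i\<close>.\<close>
    have P0: "P i = 0" if "i \<le> k" for i
    proof (rule ccontr)
      assume Pi: "P i \<noteq> 0"
      have iK: "K = (K - i) + i" "K - i \<ge> 1" using that by (auto simp: K_def)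
      have "pcompose (P K) f * [:0, 1:] ^ K * P i = (pcompose (P K) f * [:0, 1:] ^ (K - i) * P i) * [:0, 1:] ^ i"
        by (subst iK(1)) (simp only: power_add mult_ac)
      then have "(P K * pcompose (P i) f * [:1, 1:] ^ (K - i)) * [:0, 1:] ^ i
          = (pcompose (P K) f * [:0, 1:] ^ (K - i) * P i) * [:0, 1:] ^ i"
        using R0[OF that] by (simp only: R_def right_minus_eq)
      then have "P K * pcompose (P i) f * [:1, 1:] ^ (K - i) = pcompose (P K) f * [:0, 1:] ^ (K - i) * P i"
        by (simp only: mult_cancel_right) simp
      then show False
        using no_rational_solution[OF degree_f exceptional_point Pi PK iK(2)] by blast
    qed
    have EK: "E P K = (\<lambda>n. real_of_int (poly (P K) (X n)) * \<phi> n ^ K)"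
      by (rule ext) (simp add: E_def K_def P0)
    \<comment> \<open>Only the leading term is left, and dividing by \<open>\<phi> n ^ K\<close>,
      which tends to 1, shows that \<open>P K\<close> itself is flat along the orbit.\<close>
    have "(\<lambda>n. inverse (\<phi> n) ^ K) \<longlonglongrightarrow> inverse 1 ^ K"
      by (intro tendsto_intros \<phi>_tendsto) simp
    then have "flat (\<lambda>n. inverse (\<phi> n) ^ K * E P K n)"
      using flat_mult[OF flatE ord_le_tendsto] by blast
    moreover have "eventually (\<lambda>n. inverse (\<phi> n) ^ K * E P K n = real_of_int (poly (P K) (X n))) sequentially"
      using \<phi>_eventually_nonzero by eventually_elim (simp add: EK field_simps)
    ultimately have "flat (\<lambda>n. real_of_int (poly (P K) (X n)))"
      unfolding flat_def ord_le_def by (simp add: landau_o.big.in_cong)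
    then show False using PK flat_poly_imp_0 by blast
  qed
  have "E P K = E P k" using PK by (auto simp: E_def K_def)
  then have "P i = 0" if "i \<le> k" for i using Suc.IH flatE that by simp
  then show ?case using PK Suc.prems(2) by (auto simp: K_def le_Suc_eq)
qed

lemma E_eventually_nonzero:
  assumes "i \<le> k" "P i \<noteq> 0"
  shows "eventually (\<lambda>n. E P k n \<noteq> 0) sequentially"
  using flat_E_imp_0[of P k i] E_eventually_nonzero_or_ord_le[of P k] assms unfolding flat_def by blast

section \<open>Construction of the auxiliary polynomials\<close>

lemma auxiliary_polynomials:
  obtains P i where "i \<le> k" "P i \<noteq> 0" "\<And>i. i \<le> k \<Longrightarrow> degree (P i) \<le> N"
    "ord_le (- int (k * (N + 1))) (E P k)"
proof (cases "k = 0")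
  case True
  show ?thesis
  proof (rule that[of 0 "\<lambda>_. 1"])
    have "E (\<lambda>_. 1) k = (\<lambda>_. 1)" using True by (auto simp: E_def)
    then show "ord_le (- int (k * (N + 1))) (E (\<lambda>_. 1) k)" using True ord_le_const[of 1] by simp
  qed auto
next
  case False
  \<comment> \<open>\<open>L\<close> is one less than the number \<open>(k + 1) * (N + 1)\<close> of
    unknown coefficients. It also serves as the length of the finite product, where the error order
    \<open>N - L\<close> is exactly \<open>- k * (N + 1)\<close>.\<close>
  define L where "L = k * (N + 1) + N"
  define \<delta> where "\<delta> = degree (den L)"
  define I where "I = {..k} \<times> {..N}"
  have cardI: "card I = Suc L" by (simp add: I_def L_def algebra_simps)
  \<comment> \<open>\<open>T P k L\<close> is linear in the unknowns: \<open>B (i, s)\<close> is the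
    contribution of the monomial \<open>x ^ s * \<phi> ^ i\<close>, and \<open>a t\<close> reads off
    coefficient number \<open>t\<close> counted down from degree \<open>k * \<delta> + N\<close>.
    The equations kill the top \<open>L\<close> of these.\<close>
  define B where "B = (\<lambda>(i, s). monom 1 s * num L ^ i * den L ^ (k - i))"
  define a where "a t p = coeff (B p) (k * \<delta> + N - t)" for t p
  define A where "A = (\<Sum>t<L. \<Sum>p\<in>I. nat \<bar>a t p\<bar>) + 1"
  have aA: "\<bar>a t p\<bar> \<le> int A" if "t < L" "p \<in> I" for t p
  proof -
    have "nat \<bar>a t p\<bar> \<le> (\<Sum>p\<in>I. nat \<bar>a t p\<bar>)" using that by (intro member_le_sum) (auto simp: I_def)
    also have "\<dots> \<le> (\<Sum>t<L. \<Sum>p\<in>I. nat \<bar>a t p\<bar>)"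
      using that by (intro member_le_sum[of t "{..<L}" "\<lambda>t. \<Sum>p\<in>I. nat \<bar>a t p\<bar>"]) auto
    finally show ?thesis unfolding A_def by linarith
  qed
  obtain c where c: "\<exists>p\<in>I. c p \<noteq> 0" "\<And>t. t < L \<Longrightarrow> (\<Sum>p\<in>I. a t p * c p) = 0"
    using siegel_lemma[of I L A a] cardI aA by (auto simp: A_def)
  define P where "P i = (\<Sum>s\<le>N. monom (c (i, s)) s)" for i
  obtain i0 s0 where wit: "i0 \<le> k" "s0 \<le> N" "c (i0, s0) \<noteq> 0" using c(1) by (auto simp: I_def)
  have "coeff (P i0) s0 = c (i0, s0)" using wit by (simp add: P_def coeff_sum)
  then have P0: "P i0 \<noteq> 0" using wit by auto
  have degP: "degree (P i) \<le> N" for i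
    unfolding P_def by (intro degree_sum_le) (auto intro: order_trans[OF degree_monom_le])
  have "T P k L = (\<Sum>i\<le>k. \<Sum>s\<le>N. smult (c (i, s)) (B (i, s)))"
    unfolding T_def P_def sum_distrib_right
    by (intro sum.cong refl) (simp add: B_def mult.assoc smult_monom flip: mult_smult_left)
  also have "\<dots> = (\<Sum>p\<in>I. smult (c p) (B p))" unfolding I_def by (simp add: sum.cartesian_product)
  finally have TI: "T P k L = (\<Sum>p\<in>I. smult (c p) (B p))" .
  have degB: "degree (B p) \<le> k * \<delta> + N" if "p \<in> I" for p
  proof -
    obtain i s where p: "p = (i, s)" "i \<le> k" "s \<le> N" using \<open>p \<in> I\<close> by (auto simp: I_def)
    have "degree (B p) \<le> degree (monom (1::int) s) + degree (num L ^ i) + degree (den L ^ (k - i))"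
      unfolding p B_def by (auto intro: order_trans[OF degree_mult_le] add_mono)
    also have "\<dots> \<le> s + \<delta> * i + \<delta> * (k - i)"
      by (intro add_mono degree_monom_le order_trans[OF degree_power_le]) (simp_all add: degree_num \<delta>_def)
    also have "\<dots> = s + \<delta> * (i + (k - i))" by (simp only: distrib_left add.assoc)
    also have "\<dots> \<le> k * \<delta> + N" using p by (simp add: mult.commute)
    finally show ?thesis .
  qed
  \<comment> \<open>This keeps the natural number \<open>k * \<delta> + N - L\<close> from being
    truncated at zero.\<close>
  have "L \<le> \<delta>" unfolding \<delta>_def by (rule degree_den_ge)
  then have Lk: "L \<le> k * \<delta> + N" using False by (cases k) auto
  have "degree (T P k L) \<le> k * \<delta> + N - L"
  proof (rule degree_le, intro allI impI)
    fix u assume u: "k * \<delta> + N - L < u"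
    show "coeff (T P k L) u = 0"
    proof (cases "u \<le> k * \<delta> + N")
      case True
      define t where "t = k * \<delta> + N - u"
      have t: "u = k * \<delta> + N - t" "t < L" using True u Lk by (auto simp: t_def)
      have "coeff (T P k L) u = (\<Sum>p\<in>I. a t p * c p)"
        unfolding TI t(1) by (simp add: coeff_sum a_def mult_ac)
      then show ?thesis using c(2) t by simp
    next
      case False
      then have "coeff (B p) u = 0" if "p \<in> I" for p using degB[OF that] by (intro coeff_eq_0) simp
      then show ?thesis unfolding TI by (simp add: coeff_sum)
    qed
  qed
  from ord_le_E\<rho>[OF this] have "ord_le (int (k * \<delta> + N - L) - int (k * \<delta>)) (E\<rho> P k L)" by (simp add: \<delta>_def)
  moreover have "int (k * \<delta> + N - L) - int (k * \<delta>) = - int (k * (N + 1))"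
    using Lk by (simp add: of_nat_diff L_def)
  ultimately have 1: "ord_le (- int (k * (N + 1))) (E\<rho> P k L)" by simp
  have 2: "ord_le (- int (k * (N + 1))) (\<lambda>n. E P k n - E\<rho> P k L n)"
    using ord_le_E_minus_E\<rho>[of k P N L] degP by (simp add: L_def)
  have "ord_le (- int (k * (N + 1))) (E P k)" using ord_le_add[OF 2 1] by simp
  then show ?thesis using wit(1) P0 degP by (intro that[of i0 P]) auto
qed

section \<open>Conflict with Liouville's inequality\<close>

lemma ord_le_prod_X_add_1: "ord_le 1 (\<lambda>n. real_of_int (\<Prod>j<n. X j + 1))"
proof -
  define p where "p n = \<bar>real_of_int (\<Prod>j<n. X j + 1)\<bar>" for n
  obtain n0 where n0: "\<And>i. i \<ge> n0 \<Longrightarrow> Y i \<ge> 2 \<and> 4 * Y i ^ 2 \<le> Y (Suc i)"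
    using growth unfolding eventually_sequentially by blast
  have "p n \<le> p n0 / Y n0 * Y n" if "n \<ge> n0" for n
    using that
  proof (induction n rule: dec_induct)
    case base
    show ?case using Y_pos[of n0] by simp
  next
    case (step n)
    have g: "Y n \<ge> 2" "4 * Y n ^ 2 \<le> Y (Suc n)" using n0 step by auto
    have c: "p n0 / Y n0 \<ge> 0" using Y_pos[of n0] by (simp add: p_def)
    have "p (Suc n) = p n * \<bar>real_of_int (X n) + 1\<bar>" by (simp add: p_def abs_mult)
    \<comment> \<open>The new factor is at most \<open>2 * Y n\<close>, and the quadratic growth of
      the orbit makes \<open>2 * Y n ^ 2 \<le> Y (Suc n)\<close>.\<close>
    also have "\<dots> \<le> (p n0 / Y n0 * Y n) * (2 * Y n)"
      using step.IH g(1) c Y_pos[of n] by (intro mult_mono) (auto simp: Y_def)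
    also have "\<dots> = p n0 / Y n0 * (2 * Y n ^ 2)" by (simp add: power2_eq_square)
    also have "\<dots> \<le> p n0 / Y n0 * Y (Suc n)"
    proof (rule mult_left_mono[OF _ c])
      have "2 * Y n ^ 2 \<le> 4 * Y n ^ 2" by simp
      then show "2 * Y n ^ 2 \<le> Y (Suc n)" using g(2) by linarith
    qed
    finally show ?case .
  qed
  then show ?thesis
    by (intro ord_le_eventually[of _ "p n0 / Y n0"])
      (auto simp: eventually_sequentially p_def intro!: exI[of _ n0])
qed

lemma \<phi>_0_not_algebraic:
  assumes "\<And>n. X n \<noteq> -1" "\<phi> 0 \<noteq> 0"
  shows "\<not> algebraic (\<phi> 0)"
proof
  assume alg: "algebraic (\<phi> 0)"
  define \<alpha> where "\<alpha> = \<phi> 0"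
  define p where "p n = (\<Prod>j<n. X j + 1)" for n
  define q where "q n = (\<Prod>j<n. X j)" for n
  have pnz: "p n \<noteq> 0" for n
    using assms(1) by (auto simp: p_def add_eq_0_iff2)
  have \<phi>: "real_of_int (p n) * \<phi> n = \<alpha> * real_of_int (q n)" for n
  proof (induction n)
    case (Suc n)
    have "\<phi> n * real_of_int (X n) = (real_of_int (X n) + 1) * \<phi> (Suc n)"
      using X_nonzero[of n] by (subst \<phi>_Suc) (simp add: field_simps)
    then have "real_of_int (p (Suc n)) * \<phi> (Suc n) = real_of_int (p n) * \<phi> n * real_of_int (X n)"
      by (simp add: p_def mult_ac)
    then show ?case by (simp add: Suc.IH q_def)
  qed (simp add: p_def q_def \<alpha>_def)
  obtain D where D: "D \<ge> 1" and lio: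
    "\<And>k. \<exists>c>0. \<forall>(B::int poly) (H::nat). degree B \<le> k \<longrightarrow> H \<ge> 1 \<longrightarrow> (\<forall>i. \<bar>coeff B i\<bar> \<le> int H) \<longrightarrow>
        poly (of_int_poly B) \<alpha> \<noteq> 0 \<longrightarrow> c \<le> \<bar>poly (of_int_poly B) \<alpha>\<bar> * real H ^ (D - 1)"
    using algebraic_liouville_bound[OF alg] unfolding \<alpha>_def by blast
  \<comment> \<open>In the final count the exponent is \<open>D * D - N - D\<close>, so this choice
    makes it \<open>- D\<close>.\<close>
  define N where "N = D * D"
  obtain c where c: "c > 0" and lioD: "\<And>(B::int poly) (H::nat). degree B \<le> D \<Longrightarrow> H \<ge> 1 \<Longrightarrow>
        (\<And>i. \<bar>coeff B i\<bar> \<le> int H) \<Longrightarrow>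
        poly (of_int_poly B) \<alpha> \<noteq> 0 \<Longrightarrow> c \<le> \<bar>poly (of_int_poly B) \<alpha>\<bar> * real H ^ (D - 1)"
    using lio[of D] by blast
  obtain P i0 where P: "i0 \<le> D" "P i0 \<noteq> 0" "\<And>i. i \<le> D \<Longrightarrow> degree (P i) \<le> N"
    "ord_le (- int (D * (N + 1))) (E P D)"
    using auxiliary_polynomials[of D N] by blast
  \<comment> \<open>Since \<open>p n * \<phi> n = \<alpha> * q n\<close>, these integers are the
    coefficients of \<open>p n ^ D * E P D n\<close> as a polynomial in
    \<open>\<alpha>\<close>.\<close>
  define b where "b n i = poly (P i) (X n) * q n ^ i * p n ^ (D - i)" for n i
  define B where "B n = (\<Sum>i\<le>D. monom (b n i) i)" for n
  define H where "H n = nat (\<Sum>i\<le>D. \<bar>b n i\<bar>) + 1" for n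
  have coB: "coeff (B n) i = (if i \<le> D then b n i else 0)" for n i
    by (auto simp: B_def coeff_sum)
  have degB: "degree (B n) \<le> D" for n
    by (rule degree_le) (simp add: coB)
  have Hb: "\<bar>coeff (B n) i\<bar> \<le> int (H n)" for n i
  proof (cases "i \<le> D")
    case True
    then have "\<bar>b n i\<bar> \<le> (\<Sum>i\<le>D. \<bar>b n i\<bar>)" by (intro member_le_sum) auto
    then show ?thesis using True unfolding coB H_def by simp
  qed (simp add: coB)
  have B\<alpha>: "poly (of_int_poly (B n)) \<alpha> = real_of_int (p n) ^ D * E P D n" for n
  proof -
    have "poly (of_int_poly (B n)) \<alpha> = (\<Sum>i<Suc D. real_of_int (coeff (B n) i) * \<alpha> ^ i)"
      using degB[of n] by (intro poly_of_int_poly_eq_sum) simp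
    also have "\<dots> = (\<Sum>i\<le>D. real_of_int (b n i) * \<alpha> ^ i)"
      unfolding lessThan_Suc_atMost by (intro sum.cong refl) (simp add: coB)
    also have "\<dots> = (\<Sum>i\<le>D. real_of_int (poly (P i) (X n)) * (real_of_int (p n) * \<phi> n) ^ i * real_of_int (p n) ^ (D - i))"
      unfolding \<phi> by (intro sum.cong refl) (simp add: b_def power_mult_distrib mult_ac)
    also have "\<dots> = (\<Sum>i\<le>D. real_of_int (p n) ^ D * (real_of_int (poly (P i) (X n)) * \<phi> n ^ i))"
    proof (intro sum.cong refl)
      fix i assume "i \<in> {..D}"
      then have "real_of_int (p n) ^ D = real_of_int (p n) ^ i * real_of_int (p n) ^ (D - i)"
        by (simp flip: power_add)
      then show "real_of_int (poly (P i) (X n)) * (real_of_int (p n) * \<phi> n) ^ i * real_of_int (p n) ^ (D - i)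
         = real_of_int (p n) ^ D * (real_of_int (poly (P i) (X n)) * \<phi> n ^ i)"
        by (simp add: power_mult_distrib mult_ac)
    qed
    finally show ?thesis by (simp add: E_def sum_distrib_left)
  qed
  have op: "ord_le 1 (\<lambda>n. real_of_int (p n))" unfolding p_def by (rule ord_le_prod_X_add_1)
  \<comment> \<open>The size of \<open>q n\<close> follows from that of \<open>p n\<close>, because
    \<open>\<phi>\<close> is bounded and \<open>\<alpha>\<close> is nonzero.\<close>
  have "real_of_int (q n) = inverse \<alpha> * (real_of_int (p n) * \<phi> n)" for n
    unfolding \<phi> using assms(2) by (simp add: \<alpha>_def)
  then have oq: "ord_le 1 (\<lambda>n. real_of_int (q n))"
    using ord_le_mult[OF ord_le_const[of "inverse \<alpha>"] ord_le_mult[OF op ord_le_tendsto[OF \<phi>_tendsto]]] by simp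
  have ob: "ord_le (int (N + D)) (\<lambda>n. \<bar>real_of_int (b n i)\<bar>)" if "i \<le> D" for i
  proof -
    have "ord_le (int N + int i * 1 + int (D - i) * 1) (\<lambda>n. real_of_int (b n i))"
      unfolding b_def of_int_mult of_int_power
      by (intro ord_le_mult ord_le_power ord_le_poly P(3) that op oq)
    moreover have "int N + int i * 1 + int (D - i) * 1 = int (N + D)" using that by simp
    ultimately show ?thesis unfolding ord_le_def by simp
  qed
  have "real (H n) = (\<Sum>i\<le>D. \<bar>real_of_int (b n i)\<bar>) + 1" for n
    unfolding H_def by (simp add: sum_nonneg)
  then have oH: "ord_le (int (N + D)) (\<lambda>n. real (H n))"
    using ord_le_add[OF ord_le_sum[of "{..D}", OF ob] ord_le_mono[OF ord_le_const[of 1], of "int (N + D)"]] by simp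
  \<comment> \<open>The three summands come from \<open>p n ^ D\<close>, from the smallness of
    \<open>E P D\<close>, and from the height \<open>H n\<close> in Liouville's inequality.\<close>
  have "ord_le (int D * 1 + - int (D * (N + 1)) + int (D - 1) * int (N + D))
      (\<lambda>n. poly (of_int_poly (B n)) \<alpha> * real (H n) ^ (D - 1))"
    unfolding B\<alpha> by (intro ord_le_mult ord_le_power op oH P(4))
  moreover have "int D * 1 + - int (D * (N + 1)) + int (D - 1) * int (N + D) = - int D"
    using D by (simp add: N_def of_nat_diff algebra_simps)
  ultimately have small: "ord_le (- int D) (\<lambda>n. poly (of_int_poly (B n)) \<alpha> * real (H n) ^ (D - 1))" by simp
  have "eventually (\<lambda>n. c * Y n powi 0 \<le> \<bar>poly (of_int_poly (B n)) \<alpha> * real (H n) ^ (D - 1)\<bar>) sequentially"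
    using E_eventually_nonzero[where P = P, OF P(1,2)]
  proof eventually_elim
    case (elim n)
    then have "poly (of_int_poly (B n)) \<alpha> \<noteq> 0" using pnz[of n] by (simp add: B\<alpha>)
    then have "c \<le> \<bar>poly (of_int_poly (B n)) \<alpha>\<bar> * real (H n) ^ (D - 1)"
      by (intro lioD degB Hb) (simp add: H_def)
    then show ?case by (simp add: abs_mult)
  qed
  from ord_le_imp_exponent_le[OF small c this] show False using D by simp
qed

end

section \<open>Transcendence of the infinite product\<close>

theorem theorem5p2:
  fixes f :: "int poly" and M :: int
  assumes "degree f \<ge> 3"
    and "lead_coeff f > 0"
    and "admissible_form f"
    and "M > 0"
    and "poly f M > 0"
    and "strict_mono_on {real_of_int M..} (poly (map_poly real_of_int f))"
    and "\<And>j. (poly f ^^ j) M \<noteq> 0 \<and> (poly f ^^ j) M \<noteq> -1"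
    and "convergent_prod (orbit_factor f M)"
  shows "\<not> algebraic (\<Prod>j. orbit_factor f M j)"
proof
  assume alg: "algebraic (\<Prod>j. orbit_factor f M j)"
  define X where "X n = (poly f ^^ n) M" for n
  define \<alpha> where "\<alpha> = (\<Prod>j. orbit_factor f M j)"
  define pp where "pp n = (\<Prod>j<n. orbit_factor f M j)" for n
  \<comment> \<open>Dividing the product by its first \<open>n\<close> factors gives the tails; they
    tend to 1 because \<open>\<alpha>\<close> is nonzero.\<close>
  define \<phi> where "\<phi> n = \<alpha> / pp n" for n
  have X: "X n \<noteq> 0" "X n \<noteq> -1" for n using assms(7) by (auto simp: X_def)
  have fac: "orbit_factor f M n = 1 + 1 / real_of_int (X n)" for n by (simp add: orbit_factor_def X_def)
  have fnz: "orbit_factor f M n \<noteq> 0" for n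
  proof
    assume "orbit_factor f M n = 0"
    then have "real_of_int (X n) = -1" using X(1)[of n] by (simp add: fac field_simps add_eq_0_iff)
    then show False using X(2)[of n] by linarith
  qed
  have pnz: "pp n \<noteq> 0" for n using fnz by (simp add: pp_def)
  have \<alpha>0: "\<alpha> \<noteq> 0" unfolding \<alpha>_def using assms(8) fnz by (rule prodinf_nonzero)
  have "(\<lambda>n. \<Prod>j\<le>n. orbit_factor f M j) \<longlonglongrightarrow> \<alpha>"
    unfolding \<alpha>_def using assms(8) by (rule convergent_prod_LIMSEQ)
  then have pplim: "pp \<longlonglongrightarrow> \<alpha>"
    unfolding pp_def by (subst filterlim_sequentially_Suc[symmetric]) (simp add: lessThan_Suc_atMost)
  have \<phi>lim: "\<phi> \<longlonglongrightarrow> \<alpha> / \<alpha>" unfolding \<phi>_def by (intro tendsto_intros pplim \<alpha>0)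
  \<comment> \<open>The factors of a convergent product tend to 1, so \<open>1 / X n\<close> tends
    to 0 and the orbit is unbounded.\<close>
  have "(\<lambda>n. orbit_factor f M n) \<longlonglongrightarrow> 1"
    using assms(8) by (rule convergent_prod_imp_LIMSEQ)
  then have "(\<lambda>n. orbit_factor f M n - 1) \<longlonglongrightarrow> 1 - 1" by (intro tendsto_intros)
  then have "(\<lambda>n. inverse (real_of_int (X n))) \<longlonglongrightarrow> 0" by (simp add: fac divide_inverse)
  then have "filterlim (\<lambda>n. inverse (real_of_int (X n))) (at 0) sequentially"
    using X(1) by (simp add: filterlim_at)
  then have Xinf: "filterlim (\<lambda>n. real_of_int (X n)) at_infinity sequentially"
    by (subst filterlim_inverse_at_iff[symmetric])
  interpret mahler_orbit f X \<phi>
  proof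
    show "\<phi> n = (1 + 1 / real_of_int (X n)) * \<phi> (Suc n)" for n
      using fnz[of n] pnz[of n] by (simp add: \<phi>_def pp_def flip: fac)
    show "\<phi> \<longlonglongrightarrow> 1" using \<phi>lim \<alpha>0 by simp
    show "poly f 0 \<in> {0, -1} \<or> poly f (-1) \<in> {0, -1}"
      by (rule admissible_form_exceptional_point[OF assms(3)])
  qed (use assms(1) X Xinf in \<open>auto simp: X_def\<close>)
  have "\<phi> 0 = \<alpha>" by (simp add: \<phi>_def pp_def)
  then show False
    using \<phi>_0_not_algebraic alg X(2) \<alpha>0 by (simp add: \<alpha>_def)
qed

end
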